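(* Consider the mean-field coupled LQG system with the full observation, mean-field sharing information structure described in the context, with $n$ subsystems and horizon $T$. The optimal control strategy, for the problem of finding a joint strategy $\mathbf g$ that minimizes $J(\mathbf g)$, is unique and is given by $$U^i_t = K^x_t X^i_t + (K^z_t-K^x_t) Z_t,\qquad i\in\{1,\dots,n\}.$$ The optimal gains are given as follows. For the terminal time-step, $K^x_T=K^z_T=0_{d_u\times d_x}$ (the zero matrix), and for $t\le T-1$, $$K^x_t=-\left(B_t^\top M^x_{t+1}B_t+R_t\right)^{-1}B_t^\top M^x_{t+1}A_t,\qquad K^z_t=-\left(B_t^\top M^z_{t+1}B_t+R_t\right)^{-1}B_t^\top M^z_{t+1}\bar A_t,$$ where $\bar A_t=A_t+D_t$ and $\{M^x_t\}_{t=1}^T$, $\{M^z_t\}_{t=1}^T$ are the solutions of the following two decoupled Riccati equations: $M^x_T=Q_T$, $M^z_T=Q_T+P_T$, and for $t=T-1,\dots,1$, $$M^x_t=-A_t^\top M^x_{t+1}B_t\left(B_t^\top M^x_{t+1}B_t+R_t\right)^{-1}B_t^\top M^x_{t+1}A_t+A_t^\top M^x_{t+1}A_t+Q_t,$$ $$M^z_t=-\bar A_t^\top M^z_{t+1}B_t\left(B_t^\top M^z_{t+1}B_t+R_t\right)^{-1}B_t^\top M^z_{t+1}\bar A_t+\bar A_t^\top M^z_{t+1}\bar A_t+Q_t+P_t.$$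
   Context: Setting. There are $n$ homogeneous subsystems, each with a co-located controller, and a finite horizon $T$. Subsystem $i\in\{1,\dots,n\}$ has state $X^i_t\in\mathbb R^{d_x}$ and control action $U^i_t\in\mathbb R^{d_u}$ at time $t\in\{1,\dots,T\}$. Write $\mathbf X_t=(X^1_t,\dots,X^n_t)$, $\mathbf U_t=(U^1_t,\dots,U^n_t)$, and let $Z_t=\frac1n\sum_{i=1}^n X^i_t$ be the mean-field of the states. The notation $X_{1:t}$ stands for $(X_1,\dots,X_t)$. Dynamics: $X^i_{t+1}=A_tX^i_t+B_tU^i_t+D_tZ_t+W^i_t$, where $A_t,B_t,D_t$ are matrices of appropriate dimensions. The initial states $X^1_1,\dots,X^n_1$ are independent Gaussian with zero mean and covariance $\Sigma_X$; for each $i$, $\{W^i_t\}_{t=1}^T$ is an i.i.d. noise process with $W^i_t$ Gaussian with zero mean and covariance $\Sigma_W$; the primitive random variables $\{X^i_1,W^i_1,\dots,W^i_T\}_{i=1}^n$ are independent. Per-step cost: $c_t(\mathbf X_t,\mathbf U_t,Z_t)=\frac1n\sum_{i=1}^n\left[(X^i_t)^\top Q_tX^i_t+(U^i_t)^\top R_tU^i_t\right]+Z_t^\top P_tZ_t$, where $Q_t,P_t,R_t$ are matrices of appropriate dimensions, $Q_t$ and $P_t$ are symmetric and non-negative definite, and $R_t$ is symmetric and positive definite. Information structure (full observation, mean-field sharing): controller $i$ perfectly observes its local state $X^i_t$ and the mean-field $Z_t$, with perfect recall, and chooses $U^i_t=g^i_t(X^i_{1:t},U^i_{1:t-1},Z_{1:t})$.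 The function $g^i_t$ is the control law of controller $i$; $\mathbf g^i=(g^i_1,\dots,g^i_T)$ is the control strategy of controller $i$; and $\mathbf g=(\mathbf g^1,\dots,\mathbf g^n)$ is the control strategy of the system. The cost to be minimized over $\mathbf g$ is $J(\mathbf g)=\mathbb E^{\mathbf g}\left[\sum_{t=1}^Tc_t(\mathbf X_t,\mathbf U_t,Z_t)\right]$, the expectation being with respect to the measure induced on all system variables by the choice of $\mathbf g$. *)

theory Defs
  imports "HOL-Probability.Probability"
begin

definition sym_psd :: "real^'a^'a \<Rightarrow> bool" where
  "sym_psd S \<longleftrightarrow> transpose S = S \<and> (\<forall>v. 0 \<le> v \<bullet> (S *v v))"

definition sym_pd :: "real^'a^'a \<Rightarrow> bool" where
  "sym_pd S \<longleftrightarrow> transpose S = S \<and> (\<forall>v. v \<noteq> 0 \<longrightarrow> 0 < v \<bullet> (S *v v))"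

(* Gaussian laws may be degenerate, so that singular covariance matrices are covered. *)
definition gaussian_real :: "'w measure \<Rightarrow> ('w \<Rightarrow> real) \<Rightarrow> bool" where
  "gaussian_real M Y \<longleftrightarrow> Y \<in> borel_measurable M \<and>
     ((\<exists>\<mu> \<sigma>. \<sigma> > 0 \<and> distributed M lborel Y (normal_density \<mu> \<sigma>)) \<or>
      (\<exists>\<mu>. AE \<omega> in M. Y \<omega> = \<mu>))"

definition gaussian_vec :: "'w measure \<Rightarrow> ('w \<Rightarrow> real^'a) \<Rightarrow> bool" where
  "gaussian_vec M Y \<longleftrightarrow> Y \<in> borel_measurable M \<and> (\<forall>a. gaussian_real M (\<lambda>\<omega>. a \<bullet> Y \<omega>))"

definition mean_vec :: "'w measure \<Rightarrow> ('w \<Rightarrow> real^'a) \<Rightarrow> real^'a" where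
  "mean_vec M Y = (\<integral>\<omega>. Y \<omega> \<partial>M)"

definition cov_mat :: "'w measure \<Rightarrow> ('w \<Rightarrow> real^'a) \<Rightarrow> real^'a^'a" where
  "cov_mat M Y =
     (\<chi> j k. \<integral>\<omega>. (Y \<omega> - mean_vec M Y) $ j * (Y \<omega> - mean_vec M Y) $ k \<partial>M)"

(* A control law maps the histories (X_{1:t}, U_{1:t-1}, Z_{1:t}) to an action.  Histories are
   extensional functions on {1..t}, {1..<t}, {1..t}, i.e. elements of the spaces info_space t. *)
type_synonym ('x, 'u) law =
  "(nat \<Rightarrow> real^'x) \<times> (nat \<Rightarrow> real^'u) \<times> (nat \<Rightarrow> real^'x) \<Rightarrow> real^'u"

definition info_space ::
  "nat \<Rightarrow> ((nat \<Rightarrow> real^'x) \<times> (nat \<Rightarrow> real^'u) \<times> (nat \<Rightarrow> real^'x)) measure" where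
  "info_space t =
     (\<Pi>\<^sub>M s\<in>{1..t}. borel) \<Otimes>\<^sub>M ((\<Pi>\<^sub>M s\<in>{1..<t}. borel) \<Otimes>\<^sub>M (\<Pi>\<^sub>M s\<in>{1..t}. borel))"

definition admissible ::
  "nat \<Rightarrow> nat \<Rightarrow> (nat \<Rightarrow> nat \<Rightarrow> ('x::finite, 'u::finite) law) \<Rightarrow> bool" where
  "admissible n T g \<longleftrightarrow> (\<forall>i\<in>{1..n}. \<forall>t\<in>{1..T}. g i t \<in> borel_measurable (info_space t))"

lemma restrict_fundef_cong [fundef_cong]:
  "I = J \<Longrightarrow> (\<And>s. s \<in> J \<Longrightarrow> f s = h s) \<Longrightarrow> restrict f I = restrict h J"
  by (auto simp: restrict_def)

(* Closed-loop trajectories for a realisation x1 of the initial states and w of the noise.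
   Time starts at 1; the value of state at time 0 is a dummy. *)
context
  fixes n :: nat
    and A :: "nat \<Rightarrow> real^'x^'x" and B :: "nat \<Rightarrow> real^'u^'x" and D :: "nat \<Rightarrow> real^'x^'x"
    and g :: "nat \<Rightarrow> nat \<Rightarrow> ('x::finite, 'u::finite) law"
    and x1 :: "nat \<Rightarrow> real^'x" and w :: "nat \<Rightarrow> nat \<Rightarrow> real^'x"
begin

function state :: "nat \<Rightarrow> nat \<Rightarrow> real^'x"
  and mean_field :: "nat \<Rightarrow> real^'x"
  and action :: "nat \<Rightarrow> nat \<Rightarrow> real^'u"
where
  "state i 0 = 0"
| "state i (Suc t) =
     (if t = 0 then x1 i
      else A t *v state i t + B t *v action i t + D t *v mean_field t + w i t)"
| "mean_field t = (1 / real n) *\<^sub>R (\<Sum>j\<in>{1..n}. state j t)"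
| "action i t =
     g i t (restrict (\<lambda>s. state i s) {1..t},
            restrict (\<lambda>s. action i s) {1..<t},
            restrict (\<lambda>s. mean_field s) {1..t})"
  by pat_completeness auto
termination
  by (relation "inv_image less_than (case_sum (\<lambda>(i, t). 3 * t)
        (case_sum (\<lambda>t. 3 * t + 1) (\<lambda>(i, t). 3 * t + 2)))") auto

end

declare state.simps [simp del] mean_field.simps [simp del] action.simps [simp del]

definition stage_cost ::
  "nat \<Rightarrow> real^'x^'x \<Rightarrow> real^'u^'u \<Rightarrow> real^'x^'x \<Rightarrow>
   (nat \<Rightarrow> real^'x) \<Rightarrow> (nat \<Rightarrow> real^'u) \<Rightarrow> real^'x \<Rightarrow> real" where
  "stage_cost n Q R P x u z =
     (1 / real n) * (\<Sum>i\<in>{1..n}. x i \<bullet> (Q *v x i) + u i \<bullet> (R *v u i)) + z \<bullet> (P *v z)"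

(* Under the standing assumptions on Q, R, P the total cost is nonnegative, so its expectation
   always exists in [0, \<infinity>]; the truncation performed by ennreal is then immaterial. *)
definition total_cost ::
  "'w measure \<Rightarrow> nat \<Rightarrow> nat \<Rightarrow> (nat \<Rightarrow> real^'x^'x) \<Rightarrow> (nat \<Rightarrow> real^'u^'x) \<Rightarrow> (nat \<Rightarrow> real^'x^'x) \<Rightarrow>
   (nat \<Rightarrow> real^'x^'x) \<Rightarrow> (nat \<Rightarrow> real^'u^'u) \<Rightarrow> (nat \<Rightarrow> real^'x^'x) \<Rightarrow>
   (nat \<Rightarrow> 'w \<Rightarrow> real^'x) \<Rightarrow> (nat \<Rightarrow> nat \<Rightarrow> 'w \<Rightarrow> real^'x) \<Rightarrow>
   (nat \<Rightarrow> nat \<Rightarrow> ('x::finite, 'u::finite) law) \<Rightarrow> ennreal" where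
  "total_cost M n T A B D Q R P X1 W g =
     (\<integral>\<^sup>+ \<omega>. ennreal (\<Sum>t\<in>{1..T}.
        (let x1 = (\<lambda>i. X1 i \<omega>); w = (\<lambda>i t. W i t \<omega>)
         in stage_cost n (Q t) (R t) (P t)
              (\<lambda>i. state n A B D g x1 w i t)
              (\<lambda>i. action n A B D g x1 w i t)
              (mean_field n A B D g x1 w t))) \<partial>M)"

definition optimal ::
  "'w measure \<Rightarrow> nat \<Rightarrow> nat \<Rightarrow> (nat \<Rightarrow> real^'x^'x) \<Rightarrow> (nat \<Rightarrow> real^'u^'x) \<Rightarrow> (nat \<Rightarrow> real^'x^'x) \<Rightarrow>
   (nat \<Rightarrow> real^'x^'x) \<Rightarrow> (nat \<Rightarrow> real^'u^'u) \<Rightarrow> (nat \<Rightarrow> real^'x^'x) \<Rightarrow>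
   (nat \<Rightarrow> 'w \<Rightarrow> real^'x) \<Rightarrow> (nat \<Rightarrow> nat \<Rightarrow> 'w \<Rightarrow> real^'x) \<Rightarrow>
   (nat \<Rightarrow> nat \<Rightarrow> ('x::finite, 'u::finite) law) \<Rightarrow> bool" where
  "optimal M n T A B D Q R P X1 W g \<longleftrightarrow>
     admissible n T g \<and>
     (\<forall>h. admissible n T h \<longrightarrow>
        total_cost M n T A B D Q R P X1 W g \<le> total_cost M n T A B D Q R P X1 W h)"

definition mean_field_law ::
  "(nat \<Rightarrow> real^'x^'u) \<Rightarrow> (nat \<Rightarrow> real^'x^'u) \<Rightarrow>
   nat \<Rightarrow> nat \<Rightarrow> ('x::finite, 'u::finite) law" where
  "mean_field_law Kx Kz i t = (\<lambda>(x, u, z). Kx t *v x t + (Kz t - Kx t) *v z t)"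

end

theory Submission
  imports Defs
begin

text \<open>In the coordinates $X^i_t - Z_t$ and $Z_t$ (and likewise for the actions) both the dynamics and
  the cost split into decoupled linear-quadratic problems. Completing the square with the two Riccati
  matrices and telescoping gives, along every path, that the total cost equals a term depending only
  on the primitive variables, plus terms linear in the noise $W_t$ with coefficients determined by
  the past, plus a sum of positive definite forms in the deviations from the claimed law. If the
  cost of a strategy is finite then, $R_t$ being positive definite, all actions and hence all states
  are square integrable, and the linear terms have expectation zero by independence. So the claimed
  law is optimal, and a strategy is optimal only if its deviations vanish almost surely.\<close>

section \<open>Completion of squares\<close>

text \<open>A competing law is an arbitrary measurable function of the history, so neither its cost
  nor the second moments of its trajectory are known to be finite. This is why the cost identity is
  proved for each realisation separately, as an equation between real numbers, and expectations are
  taken only once integrability of each part is established. Strategies of infinite cost need no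
  comparison.

  The information structure is needed in one direction only. For the lower bound it suffices that
  actions are causal: the drift at time t is treated as a function of all primitive variables of all
  subsystems before t. The claimed law attains this bound while reading just its own state and the
  mean-field, and so it is admissible. Noise deviations from their average are dependent across
  subsystems; this is harmless, because what has to be independent is the past as a whole from the
  noise at time t as a whole.\<close>

lemma transpose_matrix_inner:
  "(transpose S *v x) \<bullet> y = x \<bullet> (S *v y)" for S :: "real^'n::finite^'m::finite"
  by (simp add: dot_lmul_matrix)

lemma inner_transpose_matrix:
  "x \<bullet> (transpose S *v y) = (S *v x) \<bullet> y" for S :: "real^'n::finite^'m::finite"
  by (metis inner_commute transpose_matrix_inner)

lemma transpose_eq_self_iff:
  "transpose S = S \<longleftrightarrow> (\<forall>x y. (S *v x) \<bullet> y = x \<bullet> (S *v y))" for S :: "real^'n::finite^'n"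
proof
  assume "transpose S = S"
  then show "\<forall>x y. (S *v x) \<bullet> y = x \<bullet> (S *v y)"
    by (metis transpose_matrix_inner)
next
  assume *: "\<forall>x y. (S *v x) \<bullet> y = x \<bullet> (S *v y)"
  have "transpose S *v x = S *v x" for x
    by (rule vector_eq_ldot[THEN iffD1, symmetric])
      (metis * inner_commute transpose_matrix_inner)
  then show "transpose S = S"
    using matrix_eq by blast
qed

lemma matrix_vector_mult_minus_left: "(- S) *v x = - (S *v x)"
  for S :: "real^'n::finite^'m::finite"
  by (simp add: matrix_vector_mult_def vec_eq_iff sum_negf)

lemma matrix_vector_mult_minus_right: "S *v (- x) = - (S *v x)"
  for S :: "real^'n::finite^'m::finite"
  by (simp add: matrix_vector_mult_def vec_eq_iff sum_negf)

lemma sym_pd_nonneg: "sym_pd S \<Longrightarrow> 0 \<le> v \<bullet> (S *v v)"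
  unfolding sym_pd_def by (metis inner_zero_left less_eq_real_def)

lemma sym_pd_imp_invertible: "sym_pd S \<Longrightarrow> invertible S"
  for S :: "real^'n::finite^'n"
  unfolding invertible_left_inverse matrix_left_invertible_ker sym_pd_def
  by (metis inner_zero_right less_irrefl)

text \<open>The quadratic form attains a positive minimum on the compact unit sphere, and
  homogeneity extends the bound to all vectors. It later turns a finite control cost into square
  integrability of the actions.\<close>

lemma sym_pd_lower_bound:
  fixes S :: "real^'n::finite^'n"
  assumes "sym_pd S"
  obtains c where "c > 0" "\<And>v. c * (norm v)\<^sup>2 \<le> v \<bullet> (S *v v)"
proof -
  have cont: "continuous_on (sphere 0 1) (\<lambda>v. v \<bullet> (S *v v))"
    by (intro continuous_intros linear_continuous_on_compose[OF continuous_on_id]) auto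
  have "sphere (0::real^'n) 1 \<noteq> {}" by simp
  then obtain v0 where v0: "v0 \<in> sphere 0 1" "\<And>v. v \<in> sphere 0 1 \<Longrightarrow> v0 \<bullet> (S *v v0) \<le> v \<bullet> (S *v v)"
    using continuous_attains_inf[OF compact_sphere _ cont] by blast
  show ?thesis
  proof
    show "v0 \<bullet> (S *v v0) > 0"
      using assms v0(1) unfolding sym_pd_def by (metis mem_sphere_0 norm_zero zero_neq_one)
    fix v :: "real^'n"
    show "v0 \<bullet> (S *v v0) * (norm v)\<^sup>2 \<le> v \<bullet> (S *v v)"
    proof (cases "v = 0")
      case False
      have "v0 \<bullet> (S *v v0) \<le> (v /\<^sub>R norm v) \<bullet> (S *v (v /\<^sub>R norm v))"
        using False by (intro v0(2)) simp
      also have "\<dots> = v \<bullet> (S *v v) / (norm v)\<^sup>2"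
        by (simp add: matrix_vector_mult_scaleR power2_eq_square divide_inverse)
      finally show ?thesis using False by (simp add: field_simps)
    qed simp
  qed
qed

lemma sym_psd_add: "sym_psd S \<Longrightarrow> sym_psd S' \<Longrightarrow> sym_psd (S + S')" for S S' :: "real^'n::finite^'n"
  unfolding sym_psd_def transpose_eq_self_iff
  by (simp add: matrix_vector_mult_add_rdistrib inner_add_left inner_add_right)

text \<open>Strictness comes from \<open>R\<close> alone, so the matrix to be inverted in the gain
  is definite even if \<open>S\<close> is singular or \<open>N\<close> has a kernel.\<close>

lemma sym_pd_congruence_add:
  fixes S :: "real^'n::finite^'n" and N :: "real^'m::finite^'n"
  assumes "sym_psd S" "sym_pd R"
  shows "sym_pd (transpose N ** S ** N + R)"
  unfolding sym_pd_def
proof safe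
  show "transpose (transpose N ** S ** N + R) = transpose N ** S ** N + R"
    using assms unfolding transpose_eq_self_iff sym_psd_def sym_pd_def
    by (auto simp: algebra_simps inner_add_left inner_add_right simp del: transpose_matrix_vector
        simp flip: matrix_vector_mul_assoc simp: transpose_matrix_inner inner_transpose_matrix)
  fix v :: "real^'m" assume "v \<noteq> 0"
  then show "0 < v \<bullet> ((transpose N ** S ** N + R) *v v)"
    using assms unfolding sym_psd_def sym_pd_def
    by (auto simp: matrix_vector_mult_add_rdistrib inner_add_right inner_transpose_matrix
        simp del: transpose_matrix_vector simp flip: matrix_vector_mul_assoc intro: add_nonneg_pos)
qed

text \<open>For \<open>S\<close> symmetric non-negative and \<open>R\<close> positive definite, the
  minimiser over u of u . R u + (A x + B u) . S (A x + B u) is this matrix applied to x. Both gains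
  are instances, with \<open>A\<close> and with \<open>A + D\<close>.\<close>

definition riccati_gain ::
  "real^'n^'n \<Rightarrow> real^'m^'n \<Rightarrow> real^'m^'m \<Rightarrow> real^'n^'n \<Rightarrow> real^'n^'m" where
  "riccati_gain A B R S =
     - (matrix_inv (transpose B ** S ** B + R) ** transpose B ** S ** A)"

text \<open>Under the same conditions this is the matrix of the minimal value over u, with the state
  cost x . Q x included.\<close>

definition riccati_step ::
  "real^'n^'n \<Rightarrow> real^'m^'n \<Rightarrow> real^'n^'n \<Rightarrow> real^'m^'m \<Rightarrow> real^'n^'n \<Rightarrow> real^'n^'n" where
  "riccati_step A B Q R S =
     - (transpose A ** S ** B ** matrix_inv (transpose B ** S ** B + R) ** transpose B ** S ** A)
     + transpose A ** S ** A + Q"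

text \<open>Closed-loop form of the Riccati equation: the inverse is absorbed into the gain, so that
  the normal equation of the gain is all that has to be known about it.\<close>

lemma riccati_step_eq:
  "riccati_step A B Q R S *v x =
     transpose A *v (S *v (A *v x + B *v (riccati_gain A B R S *v x))) + Q *v x"
  by (simp add: riccati_step_def riccati_gain_def algebra_simps matrix_vector_mult_minus_left
      matrix_vector_mult_minus_right del: transpose_matrix_vector flip: matrix_vector_mul_assoc)

text \<open>Stationarity in u. \<open>matrix_inv\<close> is defined by choice, so invertibility is
  what makes it a right inverse here.\<close>

lemma riccati_gain_normal_eq:
  assumes "invertible (transpose B ** S ** B + R)"
  shows "(transpose B ** S ** B + R) *v (riccati_gain A B R S *v x)
    = - (transpose B *v (S *v (A *v x)))"
proof -
  let ?G = "transpose B ** S ** B + R"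
  have "?G *v (riccati_gain A B R S *v x)
      = - ((?G ** matrix_inv ?G) *v (transpose B *v (S *v (A *v x))))"
    by (simp add: riccati_gain_def matrix_vector_mult_minus_left matrix_vector_mult_minus_right
        del: transpose_matrix_vector flip: matrix_vector_mul_assoc)
  then show ?thesis
    using someI_ex[OF assms[unfolded invertible_def], folded matrix_inv_def] by simp
qed

text \<open>By the normal equation the terms linear in u equal -2 u . G K x, so they complete u . G
  u to the square of u - K x. The compensating term (K x) . G K x is the correction that
  \<open>riccati_step\<close> subtracts.\<close>

lemma riccati_completion:
  fixes A Q S :: "real^'n::finite^'n" and B :: "real^'m::finite^'n"
  assumes S: "sym_psd S" and R: "sym_pd R"
  defines "G \<equiv> transpose B ** S ** B + R" and "K \<equiv> riccati_gain A B R S"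
  shows "x \<bullet> (Q *v x) + u \<bullet> (R *v u) + (A *v x + B *v u) \<bullet> (S *v (A *v x + B *v u))
    = x \<bullet> (riccati_step A B Q R S *v x) + (u - K *v x) \<bullet> (G *v (u - K *v x))"
proof -
  have pd: "sym_pd G" unfolding G_def by (rule sym_pd_congruence_add[OF S R])
  have GK: "G *v (K *v x) = - (transpose B *v (S *v (A *v x)))"
    unfolding K_def G_def
    by (rule riccati_gain_normal_eq) (rule sym_pd_imp_invertible[OF pd[unfolded G_def]])
  have symS: "(S *v y) \<bullet> z = y \<bullet> (S *v z)" for y z
    using S by (simp add: sym_psd_def transpose_eq_self_iff)
  have symG: "(K *v x) \<bullet> (G *v u) = u \<bullet> (G *v (K *v x))"
    using pd by (metis sym_pd_def transpose_eq_self_iff inner_commute)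
  have uGK: "u \<bullet> (G *v (K *v x)) = - ((B *v u) \<bullet> (S *v (A *v x)))"
    and KGK: "(K *v x) \<bullet> (G *v (K *v x)) = - ((B *v (K *v x)) \<bullet> (S *v (A *v x)))"
    unfolding GK by (simp_all add: inner_transpose_matrix del: transpose_matrix_vector)
  have uGu: "u \<bullet> (G *v u) = (B *v u) \<bullet> (S *v (B *v u)) + u \<bullet> (R *v u)"
    by (simp add: G_def matrix_vector_mult_add_rdistrib inner_add_right inner_transpose_matrix
        del: transpose_matrix_vector flip: matrix_vector_mul_assoc)
  have step: "x \<bullet> (riccati_step A B Q R S *v x)
      = (A *v x) \<bullet> (S *v (A *v x)) + (A *v x) \<bullet> (S *v (B *v (K *v x))) + x \<bullet> (Q *v x)"
    by (simp add: riccati_step_eq K_def inner_add_right inner_transpose_matrix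
        matrix_vector_right_distrib del: transpose_matrix_vector)
  have comm: "(A *v x) \<bullet> (S *v (B *v y)) = (B *v y) \<bullet> (S *v (A *v x))" for y
    by (metis symS inner_commute)
  show ?thesis
    by (simp add: step matrix_vector_mult_diff_distrib inner_diff_left inner_diff_right symG uGK KGK
        uGu matrix_vector_right_distrib inner_add_left inner_add_right comm)
qed

text \<open>By the normal equation the mixed term A^T S B K is -K^T G K, which is visibly symmetric.
  For non-negativity, choose u = K x in the completed square: the square vanishes and a sum of
  non-negative costs is left.\<close>

lemma riccati_step_psd:
  fixes A Q S :: "real^'n::finite^'n" and B :: "real^'m::finite^'n"
  assumes S: "sym_psd S" and Q: "sym_psd Q" and R: "sym_pd R"
  shows "sym_psd (riccati_step A B Q R S)"
  unfolding sym_psd_def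
proof safe
  let ?G = "transpose B ** S ** B + R" and ?K = "riccati_gain A B R S"
  have pd: "sym_pd ?G" by (rule sym_pd_congruence_add[OF S R])
  have GK: "?G *v (?K *v x) = - (transpose B *v (S *v (A *v x)))" for x
    by (rule riccati_gain_normal_eq) (rule sym_pd_imp_invertible[OF pd])
  have symS: "(S *v y) \<bullet> z = y \<bullet> (S *v z)" for y z
    using S by (simp add: sym_psd_def transpose_eq_self_iff)
  have symQ: "(Q *v y) \<bullet> z = y \<bullet> (Q *v z)" for y z
    using Q by (simp add: sym_psd_def transpose_eq_self_iff)
  have symG: "(?G *v y) \<bullet> z = y \<bullet> (?G *v z)" for y z
    using pd unfolding sym_pd_def transpose_eq_self_iff by blast
  have AK: "(A *v y) \<bullet> (S *v (B *v (?K *v x))) = - ((?K *v x) \<bullet> (?G *v (?K *v y)))" for x y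
    unfolding GK
    by (simp add: inner_transpose_matrix del: transpose_matrix_vector) (metis symS inner_commute)
  have form: "y \<bullet> (riccati_step A B Q R S *v x)
      = (A *v y) \<bullet> (S *v (A *v x)) - (?K *v x) \<bullet> (?G *v (?K *v y)) + y \<bullet> (Q *v x)" for x y
    by (simp only: riccati_step_eq inner_add_right inner_transpose_matrix
        matrix_vector_right_distrib AK diff_conv_add_uminus)
  show "transpose (riccati_step A B Q R S) = riccati_step A B Q R S"
    unfolding transpose_eq_self_iff
  proof (intro allI)
    fix x y
    have "(riccati_step A B Q R S *v x) \<bullet> y = y \<bullet> (riccati_step A B Q R S *v x)"
      by (rule inner_commute)
    also have "\<dots> = (A *v x) \<bullet> (S *v (A *v y)) - (?K *v y) \<bullet> (?G *v (?K *v x)) + x \<bullet> (Q *v y)"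
      unfolding form
      using symS[of "A *v x" "A *v y"] symG[of "?K *v x" "?K *v y"] symQ[of x y]
        inner_commute[of "A *v y" "S *v (A *v x)"] inner_commute[of "?K *v x" "?G *v (?K *v y)"]
        inner_commute[of "?K *v y" "?G *v (?K *v x)"] inner_commute[of y "Q *v x"]
      by linarith
    also have "\<dots> = x \<bullet> (riccati_step A B Q R S *v y)"
      by (simp only: form)
    finally show "(riccati_step A B Q R S *v x) \<bullet> y = x \<bullet> (riccati_step A B Q R S *v y)" .
  qed
  fix v
  have "v \<bullet> (riccati_step A B Q R S *v v)
      = v \<bullet> (Q *v v) + (?K *v v) \<bullet> (R *v (?K *v v))
        + (A *v v + B *v (?K *v v)) \<bullet> (S *v (A *v v + B *v (?K *v v)))"
    by (simp add: riccati_completion[OF S R])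
  moreover have "0 \<le> (?K *v v) \<bullet> (R *v (?K *v v))"
    using R unfolding sym_pd_def by (metis inner_zero_left less_eq_real_def)
  ultimately show "0 \<le> v \<bullet> (riccati_step A B Q R S *v v)"
    using S Q unfolding sym_psd_def by simp
qed

lemma riccati_psd:
  fixes A Q S :: "nat \<Rightarrow> real^'n::finite^'n" and B :: "nat \<Rightarrow> real^'m::finite^'n"
  assumes "S T = Q T"
    and "\<And>t. t \<in> {1..<T} \<Longrightarrow> S t = riccati_step (A t) (B t) (Q t) (R t) (S (Suc t))"
    and "\<And>t. t \<in> {1..T} \<Longrightarrow> sym_psd (Q t)" "\<And>t. t \<in> {1..T} \<Longrightarrow> sym_pd (R t)"
    and "1 \<le> t" "t \<le> T"
  shows "sym_psd (S t)"
  using assms(6,5)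
proof (induction rule: inc_induct)
  case base
  then show ?case using assms(1,3) by simp
next
  case (step t)
  then show ?case using assms(2-4) by (auto intro!: riccati_step_psd)
qed

section \<open>Averages and deviations from the average\<close>

definition average :: "nat \<Rightarrow> (nat \<Rightarrow> 'v::real_vector) \<Rightarrow> 'v" where
  "average n a = (1 / real n) *\<^sub>R (\<Sum>i\<in>{1..n}. a i)"

text \<open>Block-diagonal form in the coordinates "deviation from the average" (weight
  \<open>S\<close>) and "average" (weight \<open>Z\<close>). It takes two arguments because the
  product of drift and noise has to be expressed as well.\<close>

definition team_form ::
  "nat \<Rightarrow> real^'n^'n \<Rightarrow> real^'n^'n \<Rightarrow> (nat \<Rightarrow> real^'n) \<Rightarrow> (nat \<Rightarrow> real^'n) \<Rightarrow> real" where
  "team_form n S Z a b =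
     (1 / real n) * (\<Sum>i\<in>{1..n}. (a i - average n a) \<bullet> (S *v (b i - average n b)))
     + average n a \<bullet> (Z *v average n b)"

lemma average_add: "average n (\<lambda>i. a i + b i) = average n a + average n b"
  by (simp add: average_def sum.distrib scaleR_add_right)

lemma average_diff: "average n (\<lambda>i. a i - b i) = average n a - average n b"
  by (simp add: average_def sum_subtractf scaleR_diff_right)

lemma average_linear: "linear f \<Longrightarrow> average n (\<lambda>i. f (a i)) = f (average n a)"
  by (simp add: average_def linear_sum linear_scale)

lemma average_const: "n \<ge> 1 \<Longrightarrow> average n (\<lambda>i. c) = c"
  by (simp add: average_def sum_constant_scaleR)

lemma team_form_add:
  assumes "transpose S = S" "transpose Z = Z"
  shows "team_form n S Z (\<lambda>i. a i + b i) (\<lambda>i. a i + b i)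
    = team_form n S Z a a + 2 * team_form n S Z a b + team_form n S Z b b"
proof -
  have expand: "(x + y) \<bullet> (N *v (x + y)) = x \<bullet> (N *v x) + 2 * (x \<bullet> (N *v y)) + y \<bullet> (N *v y)"
    if "transpose N = N" for N :: "real^'a^'a" and x y
    using that unfolding transpose_eq_self_iff
    by (simp add: matrix_vector_right_distrib inner_add_left inner_add_right) (metis inner_commute)
  have dev: "a i + b i - (average n a + average n b) = (a i - average n a) + (b i - average n b)" for i
    by simp
  show ?thesis
    unfolding team_form_def average_add dev expand[OF assms(1)] expand[OF assms(2)] sum.distrib
      sum_distrib_left[symmetric]
    by (simp add: distrib_left)
qed

lemma team_form_nonneg:
  assumes "\<And>v. 0 \<le> v \<bullet> (S *v v)" "\<And>v. 0 \<le> v \<bullet> (Z *v v)"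
  shows "0 \<le> team_form n S Z a a"
  unfolding team_form_def by (intro add_nonneg_nonneg mult_nonneg_nonneg sum_nonneg assms) auto

text \<open>Definiteness of \<open>S\<close> makes all \<open>a i\<close> equal to their average,
  and definiteness of \<open>Z\<close> makes this average zero.\<close>

lemma team_form_eq_0_imp:
  assumes S: "sym_pd S" and Z: "sym_pd Z" and 0: "team_form n S Z a a = 0" and i: "i \<in> {1..n}"
  shows "a i = 0"
proof -
  have n: "n > 0" using i by simp
  have eq0: "v = 0" if "sym_pd N" "v \<bullet> (N *v v) = 0" for N :: "real^'a^'a" and v
    using that unfolding sym_pd_def by (metis less_irrefl)
  let ?s = "\<Sum>i\<in>{1..n}. (a i - average n a) \<bullet> (S *v (a i - average n a))"
  have "0 \<le> ?s" by (intro sum_nonneg sym_pd_nonneg[OF S])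
  moreover have "0 \<le> average n a \<bullet> (Z *v average n a)" by (rule sym_pd_nonneg[OF Z])
  ultimately have "(1 / real n) * ?s = 0" "average n a \<bullet> (Z *v average n a) = 0"
    using 0 unfolding team_form_def by (smt (verit) divide_nonneg_nonneg mult_nonneg_nonneg of_nat_0_le_iff)+
  then have "?s = 0" "average n a = 0"
    using n eq0[OF Z] by simp_all
  then have "(a i - average n a) \<bullet> (S *v (a i - average n a)) = 0"
    using i sum_nonneg_eq_0_iff[of "{1..n}" "\<lambda>i. (a i - average n a) \<bullet> (S *v (a i - average n a))"]
      sym_pd_nonneg[OF S] by blast
  then show ?thesis using eq0[OF S] \<open>average n a = 0\<close> by (metis diff_zero)
qed

text \<open>Parallel axis identity: deviations sum to zero, so the mixed terms cancel. As
  \<open>S\<close> may be asymmetric, the two mixed sums \<open>s1\<close> and \<open>s2\<close> are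
  computed separately.\<close>

lemma average_inner_eq:
  fixes S :: "real^'n::finite^'n"
  assumes "n \<ge> 1"
  shows "(1 / real n) * (\<Sum>i\<in>{1..n}. x i \<bullet> (S *v x i))
    = (1 / real n) * (\<Sum>i\<in>{1..n}. (x i - average n x) \<bullet> (S *v (x i - average n x)))
      + average n x \<bullet> (S *v average n x)"
proof -
  let ?m = "average n x"
  have sum: "(\<Sum>i\<in>{1..n}. x i) = real n *\<^sub>R ?m"
    using assms by (simp add: average_def)
  have s1: "(\<Sum>i\<in>{1..n}. x i \<bullet> (S *v ?m)) = real n * (?m \<bullet> (S *v ?m))"
    unfolding inner_sum_left[symmetric] sum by simp
  have s2: "(\<Sum>i\<in>{1..n}. ?m \<bullet> (S *v x i)) = real n * (?m \<bullet> (S *v ?m))"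
  proof -
    have "(\<Sum>i\<in>{1..n}. ?m \<bullet> (S *v x i)) = ?m \<bullet> (S *v (\<Sum>i\<in>{1..n}. x i))"
      by (simp only: inner_sum_right linear_sum[OF matrix_vector_mul_linear])
    then show ?thesis unfolding sum by (simp add: matrix_vector_mult_scaleR)
  qed
  have "(\<Sum>i\<in>{1..n}. (x i - ?m) \<bullet> (S *v (x i - ?m)))
    = (\<Sum>i\<in>{1..n}. x i \<bullet> (S *v x i)) - real n * (?m \<bullet> (S *v ?m))"
    unfolding matrix_vector_mult_diff_distrib inner_diff_left inner_diff_right sum_subtractf s1 s2
    by simp
  then show ?thesis using assms by (simp add: field_simps)
qed

text \<open>The mean-field penalty touches only the average coordinate. This is the origin of
  \<open>Q + P\<close> in the second Riccati equation, while \<open>R\<close> is shared by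
  both.\<close>

lemma stage_cost_eq_team_form:
  assumes "n \<ge> 1"
  shows "stage_cost n Q R P x u (average n x) = team_form n Q (Q + P) x x + team_form n R R u u"
  using average_inner_eq[OF assms, of x Q] average_inner_eq[OF assms, of u R]
  unfolding stage_cost_def team_form_def sum.distrib distrib_left matrix_vector_mult_add_rdistrib
    inner_add_right
  by linarith

text \<open>The coupling term is the same for every subsystem: it cancels in the deviations and
  turns \<open>A\<close> into \<open>A + D\<close> in the average. The claimed law splits alike,
  with the first gain acting on deviations and the second on the average. So
  \<open>riccati_completion\<close> applies once per coordinate.\<close>

lemma team_completion:
  fixes x :: "nat \<Rightarrow> real^'n::finite" and u :: "nat \<Rightarrow> real^'m::finite"
    and A D Q P S Z :: "real^'n^'n" and B :: "real^'m^'n" and R :: "real^'m^'m"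
  assumes n: "n \<ge> 1" and S: "sym_psd S" and Z: "sym_psd Z" and R: "sym_pd R"
  defines "a \<equiv> \<lambda>i. A *v x i + B *v u i + D *v average n x"
    and "d \<equiv> \<lambda>i. u i - (riccati_gain A B R S *v x i
                + (riccati_gain (A + D) B R Z - riccati_gain A B R S) *v average n x)"
  shows "stage_cost n Q R P x u (average n x) + team_form n S Z a a
    = team_form n (riccati_step A B Q R S) (riccati_step (A + D) B (Q + P) R Z) x x
      + team_form n (transpose B ** S ** B + R) (transpose B ** Z ** B + R) d d"
proof -
  note lin = average_linear[OF matrix_vector_mul_linear]
  have a: "average n a = (A + D) *v average n x + B *v average n u"
    unfolding a_def average_add lin average_const[OF n]
    by (simp add: matrix_vector_mult_add_rdistrib)
  have d: "average n d = average n u - riccati_gain (A + D) B R Z *v average n x"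
    unfolding d_def average_diff average_add lin average_const[OF n]
    by (simp add: matrix_vector_mult_diff_rdistrib)
  have ai: "a i - average n a = A *v (x i - average n x) + B *v (u i - average n u)" for i
    unfolding a by (simp add: a_def algebra_simps)
  have di: "d i - average n d = (u i - average n u) - riccati_gain A B R S *v (x i - average n x)" for i
    unfolding d by (simp add: d_def algebra_simps)
  note cS = riccati_completion[OF S R, of _ Q _ A B] and cZ = riccati_completion[OF Z R, of _ "Q + P" _ "A + D" B]
  have sumS: "(\<Sum>i\<in>{1..n}. (x i - average n x) \<bullet> (Q *v (x i - average n x)))
     + (\<Sum>i\<in>{1..n}. (u i - average n u) \<bullet> (R *v (u i - average n u)))
     + (\<Sum>i\<in>{1..n}. (a i - average n a) \<bullet> (S *v (a i - average n a)))
     = (\<Sum>i\<in>{1..n}. (x i - average n x) \<bullet> (riccati_step A B Q R S *v (x i - average n x)))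
     + (\<Sum>i\<in>{1..n}. (d i - average n d) \<bullet> ((transpose B ** S ** B + R) *v (d i - average n d)))"
    unfolding ai di sum.distrib[symmetric] cS ..
  \<comment> \<open>Combines the summed identity for the deviations, weighted by r = 1/n, with the
    one for the average.\<close>
  have scaled: "r * s1 + m1 + (r * s2 + m2) + (r * s3 + m3) = r * s4 + m4 + (r * s5 + m5)"
    if "s1 + s2 + s3 = s4 + s5" "m1 + m2 + m3 = m4 + m5" for r s1 s2 s3 s4 s5 m1 m2 m3 m4 m5 :: real
    using arg_cong[OF that(1), of "\<lambda>s. r * s"] that(2) by (simp add: distrib_left)
  show ?thesis
    unfolding stage_cost_eq_team_form[OF n] team_form_def
    by (rule scaled[OF sumS]) (simp only: a d cZ)
qed

section \<open>Square integrability\<close>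

definition sq_integrable :: "'w measure \<Rightarrow> ('w \<Rightarrow> 'v::euclidean_space) \<Rightarrow> bool" where
  "sq_integrable M f \<longleftrightarrow> f \<in> borel_measurable M \<and> integrable M (\<lambda>\<omega>. (norm (f \<omega>))\<^sup>2)"

lemma sq_integrable_measurable [measurable_dest]:
  "sq_integrable M f \<Longrightarrow> f \<in> borel_measurable M"
  by (simp add: sq_integrable_def)

lemma sq_integrable_add:
  assumes f: "sq_integrable M f" and g: "sq_integrable M g"
  shows "sq_integrable M (\<lambda>\<omega>. f \<omega> + g \<omega>)"
  unfolding sq_integrable_def
proof
  note [measurable] = sq_integrable_measurable[OF f] sq_integrable_measurable[OF g]
  show "(\<lambda>\<omega>. f \<omega> + g \<omega>) \<in> borel_measurable M" by measurable
  have bound: "(norm (x + y))\<^sup>2 \<le> 2 * (norm x)\<^sup>2 + 2 * (norm y)\<^sup>2" for x y :: 'b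
  proof -
    have "(norm (x + y))\<^sup>2 \<le> (norm x + norm y)\<^sup>2"
      by (intro power_mono norm_triangle_ineq) simp
    also have "\<dots> \<le> 2 * (norm x)\<^sup>2 + 2 * (norm y)\<^sup>2"
      using sum_squares_bound[of "norm x" "norm y"] by (simp add: power2_sum)
    finally show ?thesis .
  qed
  show "integrable M (\<lambda>\<omega>. (norm (f \<omega> + g \<omega>))\<^sup>2)"
  proof (rule Bochner_Integration.integrable_bound)
    show "integrable M (\<lambda>\<omega>. 2 * (norm (f \<omega>))\<^sup>2 + 2 * (norm (g \<omega>))\<^sup>2)"
      using f g by (auto simp: sq_integrable_def)
  qed (use bound in \<open>auto simp: abs_of_nonneg\<close>)
qed

lemma sq_integrable_bounded_linear:
  assumes f: "sq_integrable M f" and h: "bounded_linear h"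
  shows "sq_integrable M (\<lambda>\<omega>. h (f \<omega>))"
  unfolding sq_integrable_def
proof
  note [measurable] = sq_integrable_measurable[OF f]
    borel_measurable_continuous_onI[OF linear_continuous_on[OF h]]
  show hf: "(\<lambda>\<omega>. h (f \<omega>)) \<in> borel_measurable M" by measurable
  obtain K where K: "norm (h x) \<le> norm x * K" for x
    using bounded_linear.bounded[OF h] by blast
  have bound: "(norm (h x))\<^sup>2 \<le> K\<^sup>2 * (norm x)\<^sup>2" for x
    using power_mono[OF K[of x], of 2] by (simp add: power_mult_distrib mult.commute)
  show "integrable M (\<lambda>\<omega>. (norm (h (f \<omega>)))\<^sup>2)"
  proof (rule Bochner_Integration.integrable_bound)
    show "integrable M (\<lambda>\<omega>. K\<^sup>2 * (norm (f \<omega>))\<^sup>2)"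
      using f by (auto simp: sq_integrable_def)
  qed (use bound hf in \<open>auto simp: abs_of_nonneg\<close>)
qed

lemma sq_integrable_zero: "sq_integrable M (\<lambda>\<omega>. 0)"
  by (simp add: sq_integrable_def)

lemma sq_integrable_sum:
  "(\<And>i. i \<in> I \<Longrightarrow> sq_integrable M (f i)) \<Longrightarrow> sq_integrable M (\<lambda>\<omega>. \<Sum>i\<in>I. f i \<omega>)"
  by (induction I rule: infinite_finite_induct) (auto intro: sq_integrable_add sq_integrable_zero)

lemma sq_integrable_diff:
  "sq_integrable M f \<Longrightarrow> sq_integrable M g \<Longrightarrow> sq_integrable M (\<lambda>\<omega>. f \<omega> - g \<omega>)"
  using sq_integrable_add[of M f "\<lambda>\<omega>. - g \<omega>"]
    sq_integrable_bounded_linear[of M g, OF _ bounded_linear_minus[OF bounded_linear_ident]]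
  by simp

lemma sq_integrable_matrix:
  "sq_integrable M f \<Longrightarrow> sq_integrable M (\<lambda>\<omega>. S *v f \<omega>)" for S :: "real^'n::finite^'m::finite"
  by (rule sq_integrable_bounded_linear) auto

lemma sq_integrable_average:
  "(\<And>i. i \<in> {1..n} \<Longrightarrow> sq_integrable M (\<lambda>\<omega>. f \<omega> i)) \<Longrightarrow> sq_integrable M (\<lambda>\<omega>. average n (f \<omega>))"
  unfolding average_def
  by (intro sq_integrable_bounded_linear[OF _ bounded_linear_scaleR_right] sq_integrable_sum)

lemma integrable_inner_sq_integrable:
  assumes f: "sq_integrable M f" and g: "sq_integrable M g"
  shows "integrable M (\<lambda>\<omega>. f \<omega> \<bullet> g \<omega>)"
proof (rule Bochner_Integration.integrable_bound)
  note [measurable] = sq_integrable_measurable[OF f] sq_integrable_measurable[OF g]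
  show "integrable M (\<lambda>\<omega>. (norm (f \<omega>))\<^sup>2 + (norm (g \<omega>))\<^sup>2)"
    using f g by (auto simp: sq_integrable_def)
  show "(\<lambda>\<omega>. f \<omega> \<bullet> g \<omega>) \<in> borel_measurable M" by measurable
  have "\<bar>x \<bullet> y\<bar> \<le> (norm x)\<^sup>2 + (norm y)\<^sup>2" for x y :: 'b
  proof -
    have "\<bar>x \<bullet> y\<bar> \<le> norm x * norm y" by (rule Cauchy_Schwarz_ineq2)
    moreover have "2 * (norm x * norm y) \<le> (norm x)\<^sup>2 + (norm y)\<^sup>2"
      using sum_squares_bound[of "norm x" "norm y"] by simp
    moreover have "0 \<le> norm x * norm y" by simp
    ultimately show ?thesis by linarith
  qed
  then show "AE \<omega> in M. norm (f \<omega> \<bullet> g \<omega>) \<le> norm ((norm (f \<omega>))\<^sup>2 + (norm (g \<omega>))\<^sup>2)"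
    by (simp add: abs_of_nonneg)
qed

lemma (in finite_measure) integrable_sq_integrable:
  assumes f: "sq_integrable M f"
  shows "integrable M f"
proof (rule Bochner_Integration.integrable_bound)
  show "integrable M (\<lambda>\<omega>. 1 + (norm (f \<omega>))\<^sup>2)"
    using f by (auto simp: sq_integrable_def)
  show "f \<in> borel_measurable M" using f by (rule sq_integrable_measurable)
  have "r \<le> 1 + r\<^sup>2" for r :: real
    using sum_squares_bound[of r 1] zero_le_power2[of r] proof (cases "0 \<le> r")
    case False
    then have "r \<le> 0" by simp
    also have "0 \<le> 1 + r\<^sup>2" by (intro add_nonneg_nonneg) simp_all
    finally show ?thesis .
  qed auto
  then show "AE \<omega> in M. norm (f \<omega>) \<le> norm (1 + (norm (f \<omega>))\<^sup>2)"
    by (simp add: abs_of_nonneg)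
qed

lemma (in prob_space) gaussian_real_sq_integrable:
  assumes Y: "gaussian_real M Y"
  shows "integrable M (\<lambda>\<omega>. (Y \<omega>)\<^sup>2)"
proof -
  have Y_meas [measurable]: "Y \<in> borel_measurable M"
    using Y by (simp add: gaussian_real_def)
  consider (normal) \<mu> \<sigma> where "\<sigma> > 0" "distributed M lborel Y (normal_density \<mu> \<sigma>)"
    | (const) \<mu> where "AE \<omega> in M. Y \<omega> = \<mu>"
    using Y by (auto simp: gaussian_real_def)
  then show ?thesis
  proof cases
    case normal
    have "integrable M (\<lambda>\<omega>. (Y \<omega> - \<mu>)\<^sup>2)" "integrable M Y"
      using distributed_integrable[OF normal(2), of "\<lambda>x. (x - \<mu>)\<^sup>2"]
        distributed_integrable[OF normal(2), of "\<lambda>x. x"]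
        integrable_normal_moment[OF normal(1), of \<mu> 2] integrable_normal_moment_nz_1[OF normal(1), of \<mu>]
      by auto
    \<comment> \<open>The second moment used is centred at \<mu>, so the plain square is recovered
      by expanding around \<mu>.\<close>
    then have "integrable M (\<lambda>\<omega>. (Y \<omega> - \<mu>)\<^sup>2 + 2 * \<mu> * Y \<omega> - \<mu>\<^sup>2)"
      by auto
    also have "(\<lambda>\<omega>. (Y \<omega> - \<mu>)\<^sup>2 + 2 * \<mu> * Y \<omega> - \<mu>\<^sup>2) = (\<lambda>\<omega>. (Y \<omega>)\<^sup>2)"
      by (simp add: power2_eq_square algebra_simps)
    finally show ?thesis .
  next
    case const
    then have "integrable M (\<lambda>\<omega>. (Y \<omega>)\<^sup>2) \<longleftrightarrow> integrable M (\<lambda>\<omega>. \<mu>\<^sup>2)"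
      by (intro integrable_cong_AE) auto
    then show ?thesis by simp
  qed
qed

lemma (in prob_space) gaussian_vec_sq_integrable:
  assumes Y: "gaussian_vec M Y"
  shows "sq_integrable M Y"
proof -
  have "integrable M (\<lambda>\<omega>. (Y \<omega> $ j)\<^sup>2)" for j
  proof -
    have "gaussian_real M (\<lambda>\<omega>. axis j 1 \<bullet> Y \<omega>)" using Y unfolding gaussian_vec_def by blast
    from gaussian_real_sq_integrable[OF this] show ?thesis by (simp add: inner_axis')
  qed
  then have "integrable M (\<lambda>\<omega>. \<Sum>j\<in>UNIV. (Y \<omega> $ j)\<^sup>2)" by auto
  moreover have "(\<Sum>j\<in>UNIV. (v $ j)\<^sup>2) = (norm v)\<^sup>2" for v :: "real^'b"
    unfolding power2_norm_eq_inner by (simp add: inner_vec_def power2_eq_square)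
  ultimately show ?thesis using Y by (simp add: sq_integrable_def gaussian_vec_def)
qed

text \<open>In each coordinate the expectation of the product factorises, and the factor from
  \<open>S *v g\<close> vanishes since a linear image of a centred vector is centred.\<close>

lemma (in prob_space) integral_inner_indep_zero:
  fixes f g :: "'a \<Rightarrow> real^'n::finite"
  assumes ind: "indep_var borel f borel g"
    and f: "sq_integrable M f" and g: "sq_integrable M g" and g0: "(\<integral>\<omega>. g \<omega> \<partial>M) = 0"
  shows "(\<integral>\<omega>. f \<omega> \<bullet> (S *v g \<omega>) \<partial>M) = 0"
proof -
  have int: "integrable M (\<lambda>\<omega>. f \<omega> $ j)" "integrable M (\<lambda>\<omega>. (S *v g \<omega>) $ j)" for j
    using integrable_bounded_linear[OF bounded_linear_vec_nth integrable_sq_integrable[OF f]]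
      integrable_bounded_linear[OF bounded_linear_vec_nth
        integrable_sq_integrable[OF sq_integrable_matrix[OF g]]] by auto
  have lin: "bounded_linear (\<lambda>v. (S *v v) $ j)" for j
    using bounded_linear_compose[OF bounded_linear_vec_nth matrix_vector_mul_bounded_linear] .
  have zero: "(\<integral>\<omega>. (S *v g \<omega>) $ j \<partial>M) = 0" for j
    using integral_bounded_linear[OF lin integrable_sq_integrable[OF g]] by (simp add: g0)
  have ind_j: "indep_var borel (\<lambda>\<omega>. f \<omega> $ j) borel (\<lambda>\<omega>. (S *v g \<omega>) $ j)" for j
    using indep_var_compose[OF ind, of "\<lambda>v. v $ j" borel "\<lambda>v. (S *v v) $ j" borel]
      borel_measurable_continuous_onI[OF linear_continuous_on[OF lin]]
      borel_measurable_continuous_onI[OF linear_continuous_on[OF bounded_linear_vec_nth]]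
    by (simp add: comp_def)
  have "(\<integral>\<omega>. f \<omega> \<bullet> (S *v g \<omega>) \<partial>M) = (\<Sum>j\<in>UNIV. \<integral>\<omega>. f \<omega> $ j * (S *v g \<omega>) $ j \<partial>M)"
    unfolding inner_vec_def inner_real_def
    by (rule Bochner_Integration.integral_sum) (rule indep_var_integrable[OF ind_j int])
  then show ?thesis
    by (simp add: indep_var_lebesgue_integral[OF ind_j int] zero)
qed

lemma integrable_team_form:
  assumes "\<And>i. i \<in> {1..n} \<Longrightarrow> sq_integrable M (\<lambda>\<omega>. a \<omega> i)"
    and "\<And>i. i \<in> {1..n} \<Longrightarrow> sq_integrable M (\<lambda>\<omega>. b \<omega> i)"
  shows "integrable M (\<lambda>\<omega>. team_form n S Z (a \<omega>) (b \<omega>))"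
  unfolding team_form_def
  by (intro Bochner_Integration.integrable_add integrable_mult_right
      Bochner_Integration.integrable_sum integrable_inner_sq_integrable sq_integrable_matrix
      sq_integrable_diff sq_integrable_average assms)

section \<open>Closed-loop trajectories\<close>

lemma mean_field_eq_average: "mean_field n A B D g x1 w t = average n (\<lambda>i. state n A B D g x1 w i t)"
  by (simp add: mean_field.simps average_def)

lemma state_1: "state n A B D g x1 w i (Suc 0) = x1 i"
  by (simp add: state.simps)

lemma state_Suc:
  "t \<ge> 1 \<Longrightarrow> state n A B D g x1 w i (Suc t) = A t *v state n A B D g x1 w i t
     + B t *v action n A B D g x1 w i t + D t *v mean_field n A B D g x1 w t + w i t"
  by (simp add: state.simps)

lemma action_mean_field_law:
  "t \<ge> 1 \<Longrightarrow> action n A B D (mean_field_law Kx Kz) x1 w i t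
     = Kx t *v state n A B D (mean_field_law Kx Kz) x1 w i t
       + (Kz t - Kx t) *v mean_field n A B D (mean_field_law Kx Kz) x1 w t"
  by (subst action.simps) (simp add: mean_field_law_def)

text \<open>Causality: up to time t the system cannot distinguish primitives that agree before t.
  The induction is strong because an action reads its whole history; within one time step the order
  is state, mean-field, action.\<close>

lemma closed_loop_cong:
  assumes x_eq: "\<And>i. i \<in> {1..n} \<Longrightarrow> x i = x' i"
    and w_eq: "\<And>i s. i \<in> {1..n} \<Longrightarrow> 1 \<le> s \<Longrightarrow> s < t \<Longrightarrow> w i s = w' i s"
    and "s \<le> t"
  shows "i \<in> {1..n} \<Longrightarrow> state n A B D g x w i s = state n A B D g x' w' i s"
    and "mean_field n A B D g x w s = mean_field n A B D g x' w' s"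
    and "i \<in> {1..n} \<Longrightarrow> action n A B D g x w i s = action n A B D g x' w' i s"
proof -
  have "\<forall>i\<in>{1..n}. state n A B D g x w i s = state n A B D g x' w' i s
      \<and> mean_field n A B D g x w s = mean_field n A B D g x' w' s
      \<and> action n A B D g x w i s = action n A B D g x' w' i s"
    using \<open>s \<le> t\<close>
  proof (induction s rule: less_induct)
    case (less s)
    have state: "state n A B D g x w i s = state n A B D g x' w' i s" if "i \<in> {1..n}" for i
    proof (cases s)
      case (Suc r)
      then show ?thesis
        using less.IH[of r] less.prems x_eq[OF that] w_eq[OF that, of r] that
        by (auto simp: state.simps(2))
    qed (simp add: state.simps)
    have mf: "mean_field n A B D g x w s = mean_field n A B D g x' w' s"
      using state by (simp add: mean_field.simps)
    have act: "action n A B D g x w i s = action n A B D g x' w' i s" if i: "i \<in> {1..n}" for i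
    proof -
      have "state n A B D g x w i r = state n A B D g x' w' i r"
        "mean_field n A B D g x w r = mean_field n A B D g x' w' r" if "r \<le> s" for r
        using that less.IH[of r] less.prems i state[OF i] mf by (cases "r = s"; auto)+
      moreover have "action n A B D g x w i r = action n A B D g x' w' i r" if "r < s" for r
        using that less.IH[of r] less.prems i by auto
      ultimately have "restrict (state n A B D g x w i) {1..s} = restrict (state n A B D g x' w' i) {1..s}"
        "restrict (action n A B D g x w i) {1..<s} = restrict (action n A B D g x' w' i) {1..<s}"
        "restrict (mean_field n A B D g x w) {1..s} = restrict (mean_field n A B D g x' w') {1..s}"
        by (auto intro!: restrict_ext)
      then show ?thesis by (subst (1 2) action.simps) simp
    qed
    show ?case using state mf act by simp
  qed
  then show "i \<in> {1..n} \<Longrightarrow> state n A B D g x w i s = state n A B D g x' w' i s"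
    and "i \<in> {1..n} \<Longrightarrow> action n A B D g x w i s = action n A B D g x' w' i s"
    and "mean_field n A B D g x w s = mean_field n A B D g x' w' s"
    by (auto simp: mean_field.simps)
qed

lemma average_measurable:
  "(\<And>i. i \<in> {1..n} \<Longrightarrow> (\<lambda>\<xi>. f \<xi> i) \<in> borel_measurable N)
    \<Longrightarrow> (\<lambda>\<xi>. average n (f \<xi>)) \<in> borel_measurable N" for f :: "'w \<Rightarrow> nat \<Rightarrow> real^'n::finite"
  unfolding average_def by (intro borel_measurable_scaleR borel_measurable_sum) auto

lemma matrix_vector_measurable:
  "f \<in> borel_measurable N \<Longrightarrow> (\<lambda>\<xi>. S *v f \<xi>) \<in> borel_measurable N"
  for S :: "real^'n::finite^'m::finite"
  by (rule borel_measurable_continuous_on[OF linear_continuous_on]) auto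

text \<open>The space \<open>N\<close> is left open for two uses: the probability space itself, and
  the product space of the primitives before t, on which the noise at t and later is absent.\<close>

lemma closed_loop_measurable:
  assumes g: "admissible n T g"
    and x1: "\<And>i. i \<in> {1..n} \<Longrightarrow> (\<lambda>\<xi>. x1 \<xi> i) \<in> borel_measurable N"
    and w: "\<And>i s. i \<in> {1..n} \<Longrightarrow> 1 \<le> s \<Longrightarrow> s < t \<Longrightarrow> (\<lambda>\<xi>. w \<xi> i s) \<in> borel_measurable N"
    and s: "1 \<le> s" "s \<le> t" "s \<le> T"
  shows "i \<in> {1..n} \<Longrightarrow> (\<lambda>\<xi>. state n A B D g (x1 \<xi>) (w \<xi>) i s) \<in> borel_measurable N"
    and "(\<lambda>\<xi>. mean_field n A B D g (x1 \<xi>) (w \<xi>) s) \<in> borel_measurable N"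
    and "i \<in> {1..n} \<Longrightarrow> (\<lambda>\<xi>. action n A B D g (x1 \<xi>) (w \<xi>) i s) \<in> borel_measurable N"
proof -
  let ?st = "\<lambda>i s \<xi>. state n A B D g (x1 \<xi>) (w \<xi>) i s"
    and ?mf = "\<lambda>s \<xi>. mean_field n A B D g (x1 \<xi>) (w \<xi>) s"
    and ?ac = "\<lambda>i s \<xi>. action n A B D g (x1 \<xi>) (w \<xi>) i s"
  have "(\<forall>i\<in>{1..n}. ?st i s \<in> borel_measurable N \<and> ?ac i s \<in> borel_measurable N)
      \<and> ?mf s \<in> borel_measurable N"
    using s
  proof (induction s rule: less_induct)
    case (less s)
    have state: "?st i s \<in> borel_measurable N" if i: "i \<in> {1..n}" for i
    proof (cases "s = 1")
      case True
      then show ?thesis using x1[OF i] by (simp add: state_1)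
    next
      case False
      then obtain r where r: "s = Suc r" "r \<ge> 1" using less.prems by (cases s) auto
      then show ?thesis
        using less.IH[of r] less.prems w[OF i, of r] i
        by (auto simp: state_Suc intro!: borel_measurable_add matrix_vector_measurable)
    qed
    have mf: "?mf s \<in> borel_measurable N"
      unfolding mean_field_eq_average using state by (rule average_measurable)
    have act: "?ac i s \<in> borel_measurable N" if i: "i \<in> {1..n}" for i
    proof -
      have st': "?st i r \<in> borel_measurable N" if "r \<in> {1..s}" for r
        using that less.IH[of r] less.prems state[OF i] i by (cases "r = s") auto
      have mf': "?mf r \<in> borel_measurable N" if "r \<in> {1..s}" for r
        using that less.IH[of r] less.prems mf by (cases "r = s") auto
      have ac': "?ac i r \<in> borel_measurable N" if "r \<in> {1..<s}" for r
        using that less.IH[of r] less.prems i by auto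
      have "(\<lambda>\<xi>. (\<lambda>r\<in>{1..s}. ?st i r \<xi>, \<lambda>r\<in>{1..<s}. ?ac i r \<xi>, \<lambda>r\<in>{1..s}. ?mf r \<xi>))
          \<in> N \<rightarrow>\<^sub>M info_space s"
        unfolding info_space_def
        by (intro measurable_Pair measurable_restrict st' mf' ac')
      moreover have "g i s \<in> borel_measurable (info_space s)"
        using g i less.prems by (auto simp: admissible_def)
      ultimately show ?thesis
        by (subst action.simps) (rule measurable_compose)
    qed
    show ?case using state mf act by simp
  qed
  then show "i \<in> {1..n} \<Longrightarrow> ?st i s \<in> borel_measurable N"
    and "i \<in> {1..n} \<Longrightarrow> ?ac i s \<in> borel_measurable N" and "?mf s \<in> borel_measurable N"
    by auto
qed

lemma admissible_mean_field_law: "admissible n T (mean_field_law Kx Kz)"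
  unfolding admissible_def mean_field_law_def info_space_def case_prod_beta
  by (intro ballI borel_measurable_add matrix_vector_measurable
      measurable_compose[OF measurable_fst measurable_component_singleton]
      measurable_compose[OF measurable_compose[OF measurable_snd measurable_snd]
        measurable_component_singleton]) auto

section \<open>Cost decomposition\<close>

text \<open>The Gaussian laws appear here through their consequences, square integrability and zero
  mean of the noise. In \<open>indep\<close> the time index 0 carries the initial states.\<close>

locale mean_field_lqg = prob_space M for M :: "'w measure" +
  fixes n T :: nat
    and A D Q P :: "nat \<Rightarrow> real^'x::finite^'x"
    and B :: "nat \<Rightarrow> real^'u::finite^'x"
    and R :: "nat \<Rightarrow> real^'u^'u"
    and X1 :: "nat \<Rightarrow> 'w \<Rightarrow> real^'x"
    and W :: "nat \<Rightarrow> nat \<Rightarrow> 'w \<Rightarrow> real^'x"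
    and Mx Mz :: "nat \<Rightarrow> real^'x^'x"
    and Kx Kz :: "nat \<Rightarrow> real^'x^'u"
  assumes n: "n \<ge> 1" and T: "T \<ge> 1"
    and X1_sq: "i \<in> {1..n} \<Longrightarrow> sq_integrable M (X1 i)"
    and W_sq: "i \<in> {1..n} \<Longrightarrow> t \<in> {1..T} \<Longrightarrow> sq_integrable M (W i t)"
    and W_mean: "i \<in> {1..n} \<Longrightarrow> t \<in> {1..T} \<Longrightarrow> (\<integral>\<omega>. W i t \<omega> \<partial>M) = 0"
    and indep: "indep_vars (\<lambda>_. borel) (\<lambda>(i, t). if t = 0 then X1 i else W i t) ({1..n} \<times> {0..T})"
    and Q_psd: "t \<in> {1..T} \<Longrightarrow> sym_psd (Q t)"
    and P_psd: "t \<in> {1..T} \<Longrightarrow> sym_psd (P t)"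
    and R_pd: "t \<in> {1..T} \<Longrightarrow> sym_pd (R t)"
    and Mx_T: "Mx T = Q T" and Mz_T: "Mz T = Q T + P T"
    and Mx_step: "t \<in> {1..<T} \<Longrightarrow> Mx t = riccati_step (A t) (B t) (Q t) (R t) (Mx (Suc t))"
    and Mz_step: "t \<in> {1..<T} \<Longrightarrow> Mz t = riccati_step (A t + D t) (B t) (Q t + P t) (R t) (Mz (Suc t))"
    and Kx_T: "Kx T = 0" and Kz_T: "Kz T = 0"
    and Kx_step: "t \<in> {1..<T} \<Longrightarrow> Kx t = riccati_gain (A t) (B t) (R t) (Mx (Suc t))"
    and Kz_step: "t \<in> {1..<T} \<Longrightarrow> Kz t = riccati_gain (A t + D t) (B t) (R t) (Mz (Suc t))"
begin

lemma Mx_psd: "t \<in> {1..T} \<Longrightarrow> sym_psd (Mx t)"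
  using riccati_psd[of Mx T Q A B R t] Mx_T Mx_step Q_psd R_pd by auto

lemma Mz_psd: "t \<in> {1..T} \<Longrightarrow> sym_psd (Mz t)"
  using riccati_psd[of Mz T "\<lambda>t. Q t + P t" "\<lambda>t. A t + D t" B R t] Mz_T Mz_step R_pd
    sym_psd_add[OF Q_psd P_psd] by auto

text \<open>The action at time \<open>T\<close> affects no later state, so there only the control cost is left.\<close>

definition Gx :: "nat \<Rightarrow> real^'u^'u" where
  "Gx t = (if t < T then transpose (B t) ** Mx (Suc t) ** B t + R t else R t)"

definition Gz :: "nat \<Rightarrow> real^'u^'u" where
  "Gz t = (if t < T then transpose (B t) ** Mz (Suc t) ** B t + R t else R t)"

lemma Gx_pd: "t \<in> {1..T} \<Longrightarrow> sym_pd (Gx t)"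
  unfolding Gx_def using sym_pd_congruence_add[OF Mx_psd R_pd] R_pd by auto

lemma Gz_pd: "t \<in> {1..T} \<Longrightarrow> sym_pd (Gz t)"
  unfolding Gz_def using sym_pd_congruence_add[OF Mz_psd R_pd] R_pd by auto

abbreviation St where "St g i t \<omega> \<equiv> state n A B D g (\<lambda>i. X1 i \<omega>) (\<lambda>i t. W i t \<omega>) i t"
abbreviation Ac where "Ac g i t \<omega> \<equiv> action n A B D g (\<lambda>i. X1 i \<omega>) (\<lambda>i t. W i t \<omega>) i t"
abbreviation Mf where "Mf g t \<omega> \<equiv> mean_field n A B D g (\<lambda>i. X1 i \<omega>) (\<lambda>i t. W i t \<omega>) t"

definition path_cost :: "(nat \<Rightarrow> nat \<Rightarrow> ('x, 'u) law) \<Rightarrow> 'w \<Rightarrow> real" where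
  "path_cost g \<omega> = (\<Sum>t\<in>{1..T}. stage_cost n (Q t) (R t) (P t)
     (\<lambda>i. St g i t \<omega>) (\<lambda>i. Ac g i t \<omega>) (Mf g t \<omega>))"

definition deviation :: "(nat \<Rightarrow> nat \<Rightarrow> ('x, 'u) law) \<Rightarrow> nat \<Rightarrow> 'w \<Rightarrow> nat \<Rightarrow> real^'u" where
  "deviation g t \<omega> i = Ac g i t \<omega> - (Kx t *v St g i t \<omega> + (Kz t - Kx t) *v Mf g t \<omega>)"

definition drift :: "(nat \<Rightarrow> nat \<Rightarrow> ('x, 'u) law) \<Rightarrow> nat \<Rightarrow> 'w \<Rightarrow> nat \<Rightarrow> real^'x" where
  "drift g t \<omega> i = A t *v St g i t \<omega> + B t *v Ac g i t \<omega> + D t *v Mf g t \<omega>"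

text \<open>Its expectation is the optimal cost. The noise sum stops before \<open>T\<close>, since
  the noise at \<open>T\<close> reaches no state within the horizon.\<close>

definition base_cost :: "'w \<Rightarrow> real" where
  "base_cost \<omega> = team_form n (Mx 1) (Mz 1) (\<lambda>i. X1 i \<omega>) (\<lambda>i. X1 i \<omega>)
     + (\<Sum>t\<in>{1..<T}. team_form n (Mx (Suc t)) (Mz (Suc t)) (\<lambda>i. W i t \<omega>) (\<lambda>i. W i t \<omega>))"

definition cross_cost :: "(nat \<Rightarrow> nat \<Rightarrow> ('x, 'u) law) \<Rightarrow> 'w \<Rightarrow> real" where
  "cross_cost g \<omega> = (\<Sum>t\<in>{1..<T}.
     team_form n (Mx (Suc t)) (Mz (Suc t)) (drift g t \<omega>) (\<lambda>i. W i t \<omega>))"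

definition deviation_cost :: "(nat \<Rightarrow> nat \<Rightarrow> ('x, 'u) law) \<Rightarrow> 'w \<Rightarrow> real" where
  "deviation_cost g \<omega> = (\<Sum>t\<in>{1..T}. team_form n (Gx t) (Gz t) (deviation g t \<omega>) (deviation g t \<omega>))"

lemma total_cost_eq: "total_cost M n T A B D Q R P X1 W g = (\<integral>\<^sup>+ \<omega>. ennreal (path_cost g \<omega>) \<partial>M)"
  by (simp add: total_cost_def path_cost_def Let_def)

text \<open>Pathwise Bellman step for the value function with matrices \<open>Mx t\<close> and
  \<open>Mz t\<close>: expand the next value around the drift, then complete the square in the drift
  part.\<close>

lemma one_step:
  assumes t: "t \<in> {1..<T}"
  shows "stage_cost n (Q t) (R t) (P t) (\<lambda>i. St g i t \<omega>) (\<lambda>i. Ac g i t \<omega>) (Mf g t \<omega>)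
      + team_form n (Mx (Suc t)) (Mz (Suc t)) (\<lambda>i. St g i (Suc t) \<omega>) (\<lambda>i. St g i (Suc t) \<omega>)
    = team_form n (Mx t) (Mz t) (\<lambda>i. St g i t \<omega>) (\<lambda>i. St g i t \<omega>)
      + team_form n (Gx t) (Gz t) (deviation g t \<omega>) (deviation g t \<omega>)
      + 2 * team_form n (Mx (Suc t)) (Mz (Suc t)) (drift g t \<omega>) (\<lambda>i. W i t \<omega>)
      + team_form n (Mx (Suc t)) (Mz (Suc t)) (\<lambda>i. W i t \<omega>) (\<lambda>i. W i t \<omega>)"
proof -
  have psd: "sym_psd (Mx (Suc t))" "sym_psd (Mz (Suc t))" "sym_pd (R t)"
    using t Mx_psd[of "Suc t"] Mz_psd[of "Suc t"] R_pd[of t] by auto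
  have next_state: "(\<lambda>i. St g i (Suc t) \<omega>) = (\<lambda>i. drift g t \<omega> i + W i t \<omega>)"
    using t by (simp add: state_Suc drift_def)
  have drift: "drift g t \<omega> = (\<lambda>i. A t *v St g i t \<omega> + B t *v Ac g i t \<omega>
      + D t *v average n (\<lambda>i. St g i t \<omega>))"
    by (simp add: drift_def fun_eq_iff mean_field_eq_average)
  have dev: "deviation g t \<omega> = (\<lambda>i. Ac g i t \<omega> - (Kx t *v St g i t \<omega>
      + (Kz t - Kx t) *v average n (\<lambda>i. St g i t \<omega>)))"
    by (simp add: deviation_def fun_eq_iff mean_field_eq_average)
  have expand: "team_form n (Mx (Suc t)) (Mz (Suc t)) (\<lambda>i. St g i (Suc t) \<omega>) (\<lambda>i. St g i (Suc t) \<omega>)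
    = team_form n (Mx (Suc t)) (Mz (Suc t)) (drift g t \<omega>) (drift g t \<omega>)
      + 2 * team_form n (Mx (Suc t)) (Mz (Suc t)) (drift g t \<omega>) (\<lambda>i. W i t \<omega>)
      + team_form n (Mx (Suc t)) (Mz (Suc t)) (\<lambda>i. W i t \<omega>) (\<lambda>i. W i t \<omega>)"
    unfolding next_state using psd by (intro team_form_add) (auto simp: sym_psd_def)
  have "stage_cost n (Q t) (R t) (P t) (\<lambda>i. St g i t \<omega>) (\<lambda>i. Ac g i t \<omega>) (Mf g t \<omega>)
      + team_form n (Mx (Suc t)) (Mz (Suc t)) (drift g t \<omega>) (drift g t \<omega>)
    = team_form n (Mx t) (Mz t) (\<lambda>i. St g i t \<omega>) (\<lambda>i. St g i t \<omega>)
      + team_form n (Gx t) (Gz t) (deviation g t \<omega>) (deviation g t \<omega>)"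
    using team_completion[OF n psd, of "Q t" "P t" "\<lambda>i. St g i t \<omega>" "\<lambda>i. Ac g i t \<omega>" "A t" "B t" "D t"] t
    by (simp add: drift dev mean_field_eq_average Mx_step[OF t] Mz_step[OF t] Kx_step[OF t]
        Kz_step[OF t] Gx_def Gz_def)
  then show ?thesis unfolding expand by linarith
qed

lemma last_step:
  "stage_cost n (Q T) (R T) (P T) (\<lambda>i. St g i T \<omega>) (\<lambda>i. Ac g i T \<omega>) (Mf g T \<omega>)
    = team_form n (Mx T) (Mz T) (\<lambda>i. St g i T \<omega>) (\<lambda>i. St g i T \<omega>)
      + team_form n (Gx T) (Gz T) (deviation g T \<omega>) (deviation g T \<omega>)"
proof -
  have "deviation g T \<omega> = (\<lambda>i. Ac g i T \<omega>)"
    by (simp add: deviation_def fun_eq_iff Kx_T Kz_T)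
  then show ?thesis
    by (simp add: mean_field_eq_average stage_cost_eq_team_form[OF n] Mx_T Mz_T Gx_def Gz_def)
qed

lemma path_cost_eq: "path_cost g \<omega> = base_cost \<omega> + 2 * cross_cost g \<omega> + deviation_cost g \<omega>"
proof -
  let ?c = "\<lambda>t. stage_cost n (Q t) (R t) (P t) (\<lambda>i. St g i t \<omega>) (\<lambda>i. Ac g i t \<omega>) (Mf g t \<omega>)"
    and ?V = "\<lambda>t. team_form n (Mx t) (Mz t) (\<lambda>i. St g i t \<omega>) (\<lambda>i. St g i t \<omega>)"
    and ?d = "\<lambda>t. team_form n (Gx t) (Gz t) (deviation g t \<omega>) (deviation g t \<omega>)"
    and ?x = "\<lambda>t. team_form n (Mx (Suc t)) (Mz (Suc t)) (drift g t \<omega>) (\<lambda>i. W i t \<omega>)"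
    and ?w = "\<lambda>t. team_form n (Mx (Suc t)) (Mz (Suc t)) (\<lambda>i. W i t \<omega>) (\<lambda>i. W i t \<omega>)"
  \<comment> \<open>The invariant pairs the cost before time k with the value at k. The stage at
    \<open>T\<close> has no successor state and is supplied by \<open>last_step\<close>.\<close>
  have telescope: "(\<Sum>t\<in>{1..<k}. ?c t) + ?V k
      = ?V 1 + (\<Sum>t\<in>{1..<k}. ?w t) + 2 * (\<Sum>t\<in>{1..<k}. ?x t) + (\<Sum>t\<in>{1..<k}. ?d t)"
    if "1 \<le> k" "k \<le> T" for k
    using that
  proof (induction k rule: dec_induct)
    case (step t)
    then show ?case using one_step[of t g \<omega>] by (simp add: distrib_left)
  qed simp
  have split: "(\<Sum>t\<in>{1..T}. f t) = (\<Sum>t\<in>{1..<T}. f t) + f T" for f :: "nat \<Rightarrow> real"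
    using T by (simp add: sum.last_plus atLeastLessThanSuc_atLeastAtMost[symmetric])
  show ?thesis
    using telescope[OF T order_refl] last_step[of g \<omega>]
    unfolding path_cost_def base_cost_def cross_cost_def deviation_cost_def split
    by (simp add: state_1)
qed

section \<open>Bounds and measurability of the path cost\<close>

lemma stage_cost_bound:
  assumes t: "t \<in> {1..T}" and i: "i \<in> {1..n}"
  shows "u i \<bullet> (R t *v u i) / real n \<le> stage_cost n (Q t) (R t) (P t) x u z"
proof -
  have nonneg: "0 \<le> v \<bullet> (Q t *v v)" "0 \<le> v \<bullet> (P t *v v)" for v
    using Q_psd[OF t] P_psd[OF t] by (simp_all add: sym_psd_def)
  have "u i \<bullet> (R t *v u i) \<le> x i \<bullet> (Q t *v x i) + u i \<bullet> (R t *v u i)"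
    using nonneg by simp
  also have "\<dots> \<le> (\<Sum>i\<in>{1..n}. x i \<bullet> (Q t *v x i) + u i \<bullet> (R t *v u i))"
    using i nonneg sym_pd_nonneg[OF R_pd[OF t]] by (intro member_le_sum) auto
  finally have "u i \<bullet> (R t *v u i) / real n
      \<le> (1 / real n) * (\<Sum>i\<in>{1..n}. x i \<bullet> (Q t *v x i) + u i \<bullet> (R t *v u i))"
    using n by (simp add: divide_right_mono)
  then show ?thesis unfolding stage_cost_def using nonneg(2)[of z] by linarith
qed

lemma stage_cost_nonneg: "t \<in> {1..T} \<Longrightarrow> 0 \<le> stage_cost n (Q t) (R t) (P t) x u z"
  using stage_cost_bound[of t 1 u x z] n sym_pd_nonneg[OF R_pd]
  by (smt (verit) atLeastAtMost_iff divide_nonneg_nonneg of_nat_0_le_iff order_refl)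

lemma path_cost_nonneg: "0 \<le> path_cost g \<omega>"
  unfolding path_cost_def by (intro sum_nonneg stage_cost_nonneg)

lemma control_le_path_cost:
  assumes t: "t \<in> {1..T}" and i: "i \<in> {1..n}"
  shows "Ac g i t \<omega> \<bullet> (R t *v Ac g i t \<omega>) / real n \<le> path_cost g \<omega>"
proof -
  have "Ac g i t \<omega> \<bullet> (R t *v Ac g i t \<omega>) / real n \<le> stage_cost n (Q t) (R t) (P t)
     (\<lambda>i. St g i t \<omega>) (\<lambda>i. Ac g i t \<omega>) (Mf g t \<omega>)"
    by (rule stage_cost_bound[OF t i])
  also have "\<dots> \<le> path_cost g \<omega>"
    unfolding path_cost_def using t by (intro member_le_sum stage_cost_nonneg) auto
  finally show ?thesis .
qed

lemma deviation_cost_nonneg: "0 \<le> deviation_cost g \<omega>"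
  unfolding deviation_cost_def
  by (intro sum_nonneg team_form_nonneg sym_pd_nonneg[OF Gx_pd] sym_pd_nonneg[OF Gz_pd])

lemma trajectory_measurable:
  assumes "admissible n T g" "t \<in> {1..T}"
  shows "i \<in> {1..n} \<Longrightarrow> St g i t \<in> borel_measurable M" "Mf g t \<in> borel_measurable M"
    "i \<in> {1..n} \<Longrightarrow> Ac g i t \<in> borel_measurable M"
  using closed_loop_measurable[OF assms(1), of "\<lambda>\<omega> i. X1 i \<omega>" M T "\<lambda>\<omega> i t. W i t \<omega>" t]
    assms(2) X1_sq W_sq by (auto simp: sq_integrable_def)

lemma path_cost_measurable:
  assumes g: "admissible n T g"
  shows "path_cost g \<in> borel_measurable M"
  unfolding path_cost_def[abs_def] stage_cost_def
  by (intro borel_measurable_sum borel_measurable_add borel_measurable_times borel_measurable_const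
      borel_measurable_inner matrix_vector_measurable trajectory_measurable[OF g])

section \<open>Independence of the noise from the past\<close>

text \<open>Disjoint blocks of an independent family are independent, and so are measurable
  functions \<open>F\<close> and \<open>H\<close> of them.\<close>

lemma past_indep_noise:
  assumes t: "t \<in> {1..T}"
    and F: "F \<in> borel_measurable (PiM ({1..n} \<times> {0..<t}) (\<lambda>_. borel))"
    and H: "H \<in> borel_measurable (PiM ({1..n} \<times> {t}) (\<lambda>_. borel))"
  shows "indep_var borel (\<lambda>\<omega>. F (\<lambda>(i, s)\<in>{1..n} \<times> {0..<t}. if s = 0 then X1 i \<omega> else W i s \<omega>))
           borel (\<lambda>\<omega>. H (\<lambda>(i, s)\<in>{1..n} \<times> {t}. W i s \<omega>))"
proof -
  let ?X = "\<lambda>(i, t). if t = 0 then X1 i else W i t"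
  have "indep_var (PiM ({1..n} \<times> {0..<t}) (\<lambda>_. borel)) (\<lambda>\<omega>. restrict (\<lambda>k. ?X k \<omega>) ({1..n} \<times> {0..<t}))
     (PiM ({1..n} \<times> {t}) (\<lambda>_. borel)) (\<lambda>\<omega>. restrict (\<lambda>k. ?X k \<omega>) ({1..n} \<times> {t}))"
    using t by (intro indep_var_restrict[OF indep]) auto
  note ind = indep_var_compose[OF this F H]
  \<comment> \<open>As t is at least 1, the second block never meets the index 0 of the initial
    states.\<close>
  have "restrict (\<lambda>k. ?X k \<omega>) ({1..n} \<times> {0..<t})
      = (\<lambda>(i, s)\<in>{1..n} \<times> {0..<t}. if s = 0 then X1 i \<omega> else W i s \<omega>)"
    "restrict (\<lambda>k. ?X k \<omega>) ({1..n} \<times> {t}) = (\<lambda>(i, s)\<in>{1..n} \<times> {t}. W i s \<omega>)" for \<omega>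
    using t by (auto simp: restrict_def fun_eq_iff)
  then show ?thesis using ind by (simp add: comp_def)
qed

text \<open>The factorisation is explicit: \<open>F\<close> runs the closed loop on a point of the
  product space, reading its entry at (i, 0) as initial state and at (i, s) as noise. Causality
  guarantees that the discarded noise does not matter.\<close>

lemma drift_factors:
  assumes g: "admissible n T g" and t: "t \<in> {1..T}"
  obtains F where
    "\<And>i. i \<in> {1..n} \<Longrightarrow> (\<lambda>\<xi>. F \<xi> i) \<in> borel_measurable (PiM ({1..n} \<times> {0..<t}) (\<lambda>_. borel))"
    "\<And>i \<omega>. i \<in> {1..n} \<Longrightarrow> drift g t \<omega> i
       = F (\<lambda>(i, s)\<in>{1..n} \<times> {0..<t}. if s = 0 then X1 i \<omega> else W i s \<omega>) i"
proof
  let ?N = "PiM ({1..n} \<times> {0..<t}) (\<lambda>_. borel) :: (nat \<times> nat \<Rightarrow> real^'x) measure"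
  let ?x = "\<lambda>\<xi> i. \<xi> (i, 0::nat) :: real^'x" and ?w = "\<lambda>\<xi> i s. \<xi> (i, s::nat) :: real^'x"
  let ?F = "\<lambda>\<xi> i. A t *v state n A B D g (?x \<xi>) (?w \<xi>) i t
      + B t *v action n A B D g (?x \<xi>) (?w \<xi>) i t + D t *v mean_field n A B D g (?x \<xi>) (?w \<xi>) t"
  have comp: "i \<in> {1..n} \<Longrightarrow> (\<lambda>\<xi>. ?x \<xi> i) \<in> borel_measurable ?N"
    "i \<in> {1..n} \<Longrightarrow> 1 \<le> s \<Longrightarrow> s < t \<Longrightarrow> (\<lambda>\<xi>. ?w \<xi> i s) \<in> borel_measurable ?N" for i s
    using t by (auto intro!: measurable_component_singleton)
  have le: "1 \<le> t" "t \<le> t" "t \<le> T" using t by auto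
  note meas = closed_loop_measurable[OF g, of ?x ?N t ?w, OF comp le]
  show "(\<lambda>\<xi>. ?F \<xi> i) \<in> borel_measurable ?N" if "i \<in> {1..n}" for i
    using that by (intro borel_measurable_add matrix_vector_measurable meas)
  show "drift g t \<omega> i
       = ?F (\<lambda>(i, s)\<in>{1..n} \<times> {0..<t}. if s = 0 then X1 i \<omega> else W i s \<omega>) i"
    if i: "i \<in> {1..n}" for i \<omega>
  proof -
    let ?\<xi> = "\<lambda>(i, s)\<in>{1..n} \<times> {0..<t}. if s = 0 then X1 i \<omega> else W i s \<omega>"
    have eq: "j \<in> {1..n} \<Longrightarrow> X1 j \<omega> = ?x ?\<xi> j"
      "j \<in> {1..n} \<Longrightarrow> 1 \<le> s \<Longrightarrow> s < t \<Longrightarrow> W j s \<omega> = ?w ?\<xi> j s" for j s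
      using t by auto
    have "St g i t \<omega> = state n A B D g (?x ?\<xi>) (?w ?\<xi>) i t"
      "Mf g t \<omega> = mean_field n A B D g (?x ?\<xi>) (?w ?\<xi>) t"
      "Ac g i t \<omega> = action n A B D g (?x ?\<xi>) (?w ?\<xi>) i t"
      by (rule closed_loop_cong[where t = t]; use i eq in simp)+
    then show ?thesis by (simp only: drift_def)
  qed
qed

text \<open>Averages and deviations of the drift depend on the past block only, those of the noise
  on the block at time t only. So each of the n + 1 products is one of independent factors, the
  second of which is centred.\<close>

lemma integral_cross_eq_0:
  assumes g: "admissible n T g" and t: "t \<in> {1..T}"
    and sq: "\<And>i. i \<in> {1..n} \<Longrightarrow> sq_integrable M (\<lambda>\<omega>. drift g t \<omega> i)"
  shows "(\<integral>\<omega>. team_form n S Z (drift g t \<omega>) (\<lambda>i. W i t \<omega>) \<partial>M) = 0"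
proof -
  obtain F where F: "\<And>i. i \<in> {1..n} \<Longrightarrow>
      (\<lambda>\<xi>. F \<xi> i) \<in> borel_measurable (PiM ({1..n} \<times> {0..<t}) (\<lambda>_. borel))"
    and drift: "\<And>i \<omega>. i \<in> {1..n} \<Longrightarrow> drift g t \<omega> i
       = F (\<lambda>(i, s)\<in>{1..n} \<times> {0..<t}. if s = 0 then X1 i \<omega> else W i s \<omega>) i"
    using drift_factors[OF g t] by blast
  let ?H = "\<lambda>\<eta> i. \<eta> (i, t) :: real^'x"
  have H: "(\<lambda>\<eta>. ?H \<eta> i) \<in> borel_measurable (PiM ({1..n} \<times> {t}) (\<lambda>_. borel))" if "i \<in> {1..n}" for i
    using that by (auto intro!: measurable_component_singleton)
  have avg_drift: "average n (drift g t \<omega>)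
      = average n (F (\<lambda>(i, s)\<in>{1..n} \<times> {0..<t}. if s = 0 then X1 i \<omega> else W i s \<omega>))" for \<omega>
    by (simp add: average_def drift)
  have avg_W: "average n (\<lambda>i. W i t \<omega>) = average n (?H (\<lambda>(i, s)\<in>{1..n} \<times> {t}. W i s \<omega>))" for \<omega>
    by (simp add: average_def)
  have W: "W i t \<omega> = ?H (\<lambda>(i, s)\<in>{1..n} \<times> {t}. W i s \<omega>) i" if "i \<in> {1..n}" for i \<omega>
    using that by simp
  have sqW: "sq_integrable M (W i t)" if "i \<in> {1..n}" for i using W_sq[OF that t] .
  have sq_avg: "sq_integrable M (\<lambda>\<omega>. average n (drift g t \<omega>))"
    "sq_integrable M (\<lambda>\<omega>. average n (\<lambda>i. W i t \<omega>))"
    using sq sqW by (auto intro!: sq_integrable_average)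
  have mean_avg: "(\<integral>\<omega>. average n (\<lambda>i. W i t \<omega>) \<partial>M) = 0"
    unfolding average_def using integrable_sq_integrable[OF sqW] W_mean t
    by (simp add: Bochner_Integration.integral_sum)
  have ind1: "indep_var borel (\<lambda>\<omega>. drift g t \<omega> i - average n (drift g t \<omega>))
      borel (\<lambda>\<omega>. W i t \<omega> - average n (\<lambda>i. W i t \<omega>))" if i: "i \<in> {1..n}" for i
    unfolding avg_drift avg_W drift[OF i] W[OF i]
    using i F H by (intro past_indep_noise[OF t] borel_measurable_diff average_measurable)
  have ind2: "indep_var borel (\<lambda>\<omega>. average n (drift g t \<omega>)) borel (\<lambda>\<omega>. average n (\<lambda>i. W i t \<omega>))"
    unfolding avg_drift avg_W
    using F H by (intro past_indep_noise[OF t] average_measurable)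
  have int1: "(\<integral>\<omega>. (drift g t \<omega> i - average n (drift g t \<omega>))
      \<bullet> (S *v (W i t \<omega> - average n (\<lambda>i. W i t \<omega>))) \<partial>M) = 0" if i: "i \<in> {1..n}" for i
    using sq[OF i] sqW[OF i] sq_avg mean_avg W_mean[OF i t]
    by (intro integral_inner_indep_zero[OF ind1[OF i]] sq_integrable_diff)
      (auto simp: integrable_sq_integrable)
  have int2: "(\<integral>\<omega>. average n (drift g t \<omega>) \<bullet> (Z *v average n (\<lambda>i. W i t \<omega>)) \<partial>M) = 0"
    by (rule integral_inner_indep_zero[OF ind2 sq_avg mean_avg])
  have i1: "integrable M (\<lambda>\<omega>. (drift g t \<omega> i - average n (drift g t \<omega>))
      \<bullet> (S *v (W i t \<omega> - average n (\<lambda>i. W i t \<omega>))))" if i: "i \<in> {1..n}" for i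
    by (intro integrable_inner_sq_integrable sq_integrable_matrix sq_integrable_diff sq i sqW sq_avg)
  have i2: "integrable M (\<lambda>\<omega>. average n (drift g t \<omega>) \<bullet> (Z *v average n (\<lambda>i. W i t \<omega>)))"
    by (intro integrable_inner_sq_integrable sq_integrable_matrix sq_avg)
  have "integrable M (\<lambda>\<omega>. \<Sum>i\<in>{1..n}. (drift g t \<omega> i - average n (drift g t \<omega>))
      \<bullet> (S *v (W i t \<omega> - average n (\<lambda>i. W i t \<omega>))))"
    by (intro Bochner_Integration.integrable_sum i1)
  moreover have "(\<integral>\<omega>. (\<Sum>i\<in>{1..n}. (drift g t \<omega> i - average n (drift g t \<omega>))
      \<bullet> (S *v (W i t \<omega> - average n (\<lambda>i. W i t \<omega>)))) \<partial>M) = 0"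
    by (subst Bochner_Integration.integral_sum) (use i1 int1 in auto)
  ultimately show ?thesis
    unfolding team_form_def using i2 int2 by simp
qed

section \<open>Second moments and expected cost\<close>

lemma state_sq_integrable:
  assumes act: "\<And>i s. i \<in> {1..n} \<Longrightarrow> 1 \<le> s \<Longrightarrow> s < t \<Longrightarrow> sq_integrable M (Ac g i s)"
    and "1 \<le> t" "t \<le> T" "i \<in> {1..n}"
  shows "sq_integrable M (St g i t)"
  using assms(2,3,1,4)
proof (induction t arbitrary: i rule: dec_induct)
  case base
  then show ?case using X1_sq by (simp add: state_1)
next
  case (step t)
  have st: "sq_integrable M (St g j t)" if "j \<in> {1..n}" for j
    using step that by auto
  have "sq_integrable M (Mf g t)"
    unfolding mean_field_eq_average by (intro sq_integrable_average st)
  then show ?case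
    using step st by (auto simp: state_Suc intro!: sq_integrable_add sq_integrable_matrix W_sq)
qed

text \<open>Finite cost of the claimed law is not known yet, so its second moments come from
  linearity: actions before t control the state at t, which controls the action at t.\<close>

lemma mean_field_law_sq_integrable:
  assumes "t \<in> {1..T}" "i \<in> {1..n}"
  shows "sq_integrable M (Ac (mean_field_law Kx Kz) i t)"
  using assms
proof (induction t arbitrary: i rule: less_induct)
  case (less t)
  have st: "sq_integrable M (St (mean_field_law Kx Kz) j t)" if "j \<in> {1..n}" for j
    using less that by (intro state_sq_integrable) auto
  have "sq_integrable M (Mf (mean_field_law Kx Kz) t)"
    unfolding mean_field_eq_average by (intro sq_integrable_average st)
  then show ?case
    using less st by (auto simp: action_mean_field_law intro!: sq_integrable_add sq_integrable_matrix)
qed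

lemma finite_cost_sq_integrable:
  assumes g: "admissible n T g" and fin: "total_cost M n T A B D Q R P X1 W g < \<infinity>"
    and t: "t \<in> {1..T}" and i: "i \<in> {1..n}"
  shows "sq_integrable M (Ac g i t)"
proof -
  have int: "integrable M (path_cost g)"
    using fin path_cost_measurable[OF g] path_cost_nonneg
    by (intro integrableI_nonneg) (auto simp: total_cost_eq)
  obtain c where c: "c > 0" "\<And>v. c * (norm v)\<^sup>2 \<le> v \<bullet> (R t *v v)"
    using sym_pd_lower_bound[OF R_pd[OF t]] by blast
  have meas: "Ac g i t \<in> borel_measurable M" by (rule trajectory_measurable(3)[OF g t i])
  \<comment> \<open>With c from the definiteness of \<open>R t\<close>: c times the squared norm is
    at most the control cost, which is at most n times the path cost, because the stage cost
    averages over subsystems.\<close>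
  have bound: "(norm (Ac g i t \<omega>))\<^sup>2 \<le> real n / c * path_cost g \<omega>" for \<omega>
    using control_le_path_cost[OF t i, of g \<omega>] c(2)[of "Ac g i t \<omega>"] c(1) n
    by (simp add: field_simps)
  have "integrable M (\<lambda>\<omega>. (norm (Ac g i t \<omega>))\<^sup>2)"
  proof (rule Bochner_Integration.integrable_bound)
    show "integrable M (\<lambda>\<omega>. real n / c * path_cost g \<omega>)" using int by auto
    show "AE \<omega> in M. norm ((norm (Ac g i t \<omega>))\<^sup>2) \<le> norm (real n / c * path_cost g \<omega>)"
      using bound path_cost_nonneg c(1) by (auto simp: abs_of_nonneg)
  qed (use meas in measurable)
  then show ?thesis using meas by (simp add: sq_integrable_def)
qed

text \<open>The third claim ensures that \<open>ennreal\<close> truncates nothing; for the claimed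
  law it gives the sign of the expected base cost, which is needed to compare costs as real
  numbers.\<close>

lemma total_cost_decomposition:
  assumes g: "admissible n T g"
    and act: "\<And>i t. i \<in> {1..n} \<Longrightarrow> t \<in> {1..T} \<Longrightarrow> sq_integrable M (Ac g i t)"
  shows "integrable M (deviation_cost g)"
    and "total_cost M n T A B D Q R P X1 W g
      = ennreal ((\<integral>\<omega>. base_cost \<omega> \<partial>M) + (\<integral>\<omega>. deviation_cost g \<omega> \<partial>M))"
    and "0 \<le> (\<integral>\<omega>. base_cost \<omega> \<partial>M) + (\<integral>\<omega>. deviation_cost g \<omega> \<partial>M)"
proof -
  have st: "sq_integrable M (St g i t)" if "i \<in> {1..n}" "t \<in> {1..T}" for i t
    using that by (intro state_sq_integrable act) auto
  have mf: "sq_integrable M (Mf g t)" if "t \<in> {1..T}" for t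
    unfolding mean_field_eq_average by (intro sq_integrable_average st that)
  have drift: "sq_integrable M (\<lambda>\<omega>. drift g t \<omega> i)" if "i \<in> {1..n}" "t \<in> {1..T}" for i t
    unfolding drift_def using that by (intro sq_integrable_add sq_integrable_matrix st act mf)
  have dev: "sq_integrable M (\<lambda>\<omega>. deviation g t \<omega> i)" if "i \<in> {1..n}" "t \<in> {1..T}" for i t
    unfolding deviation_def using that
    by (intro sq_integrable_add sq_integrable_diff sq_integrable_matrix st act mf)
  have int_x: "integrable M (\<lambda>\<omega>. team_form n (Mx (Suc t)) (Mz (Suc t)) (drift g t \<omega>) (\<lambda>i. W i t \<omega>))"
    if "t \<in> {1..<T}" for t
    using that by (intro integrable_team_form drift W_sq) auto
  have int_base: "integrable M base_cost"
    unfolding base_cost_def[abs_def]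
    by (intro Bochner_Integration.integrable_add Bochner_Integration.integrable_sum
        integrable_team_form X1_sq W_sq) auto
  have int_cross: "integrable M (cross_cost g)"
    unfolding cross_cost_def[abs_def] by (intro Bochner_Integration.integrable_sum int_x)
  show int_dev: "integrable M (deviation_cost g)"
    unfolding deviation_cost_def[abs_def]
    by (intro Bochner_Integration.integrable_sum integrable_team_form dev)
  have cross0: "(\<integral>\<omega>. cross_cost g \<omega> \<partial>M) = 0"
    unfolding cross_cost_def
    by (subst Bochner_Integration.integral_sum)
      (auto intro!: sum.neutral int_x integral_cross_eq_0[OF g] drift)
  have int: "integrable M (path_cost g)"
    and eq: "(\<integral>\<omega>. path_cost g \<omega> \<partial>M)
      = (\<integral>\<omega>. base_cost \<omega> \<partial>M) + (\<integral>\<omega>. deviation_cost g \<omega> \<partial>M)"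
    using int_base int_cross int_dev cross0 unfolding path_cost_eq[abs_def] by auto
  show "total_cost M n T A B D Q R P X1 W g
      = ennreal ((\<integral>\<omega>. base_cost \<omega> \<partial>M) + (\<integral>\<omega>. deviation_cost g \<omega> \<partial>M))"
    unfolding total_cost_eq eq[symmetric]
    using int path_cost_nonneg by (intro nn_integral_eq_integral) auto
  show "0 \<le> (\<integral>\<omega>. base_cost \<omega> \<partial>M) + (\<integral>\<omega>. deviation_cost g \<omega> \<partial>M)"
    unfolding eq[symmetric] using path_cost_nonneg by simp
qed

lemma deviation_cost_mean_field_law: "deviation_cost (mean_field_law Kx Kz) \<omega> = 0"
proof -
  have "deviation (mean_field_law Kx Kz) t \<omega> = (\<lambda>i. 0)" if "t \<ge> 1" for t
    using that by (simp add: deviation_def fun_eq_iff action_mean_field_law)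
  then show ?thesis by (simp add: deviation_cost_def team_form_def average_def)
qed

lemma total_cost_mean_field_law:
  "total_cost M n T A B D Q R P X1 W (mean_field_law Kx Kz) = ennreal (\<integral>\<omega>. base_cost \<omega> \<partial>M)"
  "0 \<le> (\<integral>\<omega>. base_cost \<omega> \<partial>M)"
  using total_cost_decomposition[OF admissible_mean_field_law mean_field_law_sq_integrable]
  by (simp_all add: deviation_cost_mean_field_law)

section \<open>Optimality and uniqueness\<close>

lemma mean_field_law_optimal: "optimal M n T A B D Q R P X1 W (mean_field_law Kx Kz)"
  unfolding optimal_def
proof (intro conjI allI impI admissible_mean_field_law)
  fix h :: "nat \<Rightarrow> nat \<Rightarrow> ('x, 'u) law" assume h: "admissible n T h"
  show "total_cost M n T A B D Q R P X1 W (mean_field_law Kx Kz) \<le> total_cost M n T A B D Q R P X1 W h"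
  proof (cases "total_cost M n T A B D Q R P X1 W h < \<infinity>")
    case True
    then show ?thesis
      using total_cost_decomposition(2)[OF h finite_cost_sq_integrable[OF h]] deviation_cost_nonneg
      by (auto simp: total_cost_mean_field_law intro!: ennreal_leI)
  qed (simp add: not_less top_unique)
qed

text \<open>A zero deviation only says that the feedback formula holds along the trajectory of
  \<open>g\<close> itself. Forward induction from the common initial state shows that this
  trajectory is the one of the claimed law.\<close>

lemma zero_deviation_imp_actions_eq:
  assumes dev: "\<And>i s. i \<in> {1..n} \<Longrightarrow> 1 \<le> s \<Longrightarrow> s \<le> T \<Longrightarrow> deviation g s \<omega> i = 0"
    and t: "t \<in> {1..T}" and i: "i \<in> {1..n}"
  shows "Ac g i t \<omega> = Ac (mean_field_law Kx Kz) i t \<omega>"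
proof -
  let ?h = "mean_field_law Kx Kz"
  have act: "Ac g j s \<omega> = Ac ?h j s \<omega>"
    if "j \<in> {1..n}" "1 \<le> s" "s \<le> T" and st: "\<And>j. j \<in> {1..n} \<Longrightarrow> St g j s \<omega> = St ?h j s \<omega>" for j s
  proof -
    have "Mf g s \<omega> = Mf ?h s \<omega>" using st by (simp add: mean_field.simps)
    then show ?thesis
      using dev[of j s] that by (simp add: deviation_def action_mean_field_law)
  qed
  have "St g j s \<omega> = St ?h j s \<omega>" if "1 \<le> s" "s \<le> T" "j \<in> {1..n}" for j s
    using that
  proof (induction s arbitrary: j rule: dec_induct)
    case (step s)
    have "Mf g s \<omega> = Mf ?h s \<omega>" using step by (simp add: mean_field.simps)
    then show ?case using step act[of j s] by (simp add: state_Suc)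
  qed (simp add: state_1)
  then show ?thesis using act[of i t] t i by auto
qed

lemma optimal_imp_zero_deviation:
  assumes g: "optimal M n T A B D Q R P X1 W g"
  shows "AE \<omega> in M. \<forall>i\<in>{1..n}. \<forall>t\<in>{1..T}. deviation g t \<omega> i = 0"
proof -
  have adm: "admissible n T g"
    and le: "total_cost M n T A B D Q R P X1 W g \<le> ennreal (\<integral>\<omega>. base_cost \<omega> \<partial>M)"
    using g admissible_mean_field_law[of n T Kx Kz]
    unfolding optimal_def total_cost_mean_field_law(1)[symmetric] by blast+
  have fin: "total_cost M n T A B D Q R P X1 W g < \<infinity>"
    using le by (rule le_less_trans) simp
  have dec: "integrable M (deviation_cost g)"
    "total_cost M n T A B D Q R P X1 W g
      = ennreal ((\<integral>\<omega>. base_cost \<omega> \<partial>M) + (\<integral>\<omega>. deviation_cost g \<omega> \<partial>M))"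
    by (intro total_cost_decomposition finite_cost_sq_integrable adm fin; assumption)+
  have "(\<integral>\<omega>. deviation_cost g \<omega> \<partial>M) \<le> 0"
    using le total_cost_mean_field_law(2) unfolding dec(2) by (simp add: ennreal_le_iff)
  moreover have "0 \<le> (\<integral>\<omega>. deviation_cost g \<omega> \<partial>M)"
    using deviation_cost_nonneg by simp
  ultimately have "AE \<omega> in M. deviation_cost g \<omega> = 0"
    using integral_nonneg_eq_0_iff_AE[OF dec(1) AE_I2[OF deviation_cost_nonneg]] by linarith
  then show ?thesis
  \<comment> \<open>One null set serves all i and t at once, since \<open>deviation_cost\<close>
    sums over all of them; the comparison of trajectories needs all deviations to vanish at the same
    \<omega>.\<close>
  proof (rule AE_mp, intro AE_I2 impI ballI)
    fix \<omega> i t assume 0: "deviation_cost g \<omega> = 0" and i: "i \<in> {1..n}" and t: "t \<in> {1..T}"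
    have "team_form n (Gx t) (Gz t) (deviation g t \<omega>) (deviation g t \<omega>) = 0"
      using 0 t unfolding deviation_cost_def
      by (subst (asm) sum_nonneg_eq_0_iff)
        (auto intro!: team_form_nonneg sym_pd_nonneg[OF Gx_pd] sym_pd_nonneg[OF Gz_pd])
    then show "deviation g t \<omega> i = 0"
      by (rule team_form_eq_0_imp[OF Gx_pd[OF t] Gz_pd[OF t] _ i])
  qed
qed

end

text \<open>Uniqueness is stated for the actions, almost surely: laws as functions can differ on
  histories that never occur, or use past actions in place of the states that determine them. The
  invertibility claim shows that every \<open>matrix_inv\<close> in the equations is a true
  inverse.\<close>

theorem theorem1:
  fixes M :: "'w measure"
    and n T :: nat
    and A D Q P :: "nat \<Rightarrow> real^'x^'x"
    and B :: "nat \<Rightarrow> real^'u^'x"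
    and R :: "nat \<Rightarrow> real^'u^'u"
    and \<Sigma>X \<Sigma>W :: "real^'x^'x"
    and X1 :: "nat \<Rightarrow> 'w \<Rightarrow> real^'x"
    and W :: "nat \<Rightarrow> nat \<Rightarrow> 'w \<Rightarrow> real^'x"
    and Mx Mz :: "nat \<Rightarrow> real^'x^'x"
    and Kx Kz :: "nat \<Rightarrow> real^'x^'u"
  assumes "prob_space M" and "n \<ge> 1" and "T \<ge> 1"
    and "\<forall>i\<in>{1..n}. gaussian_vec M (X1 i) \<and> mean_vec M (X1 i) = 0 \<and> cov_mat M (X1 i) = \<Sigma>X"
    and "\<forall>i\<in>{1..n}. \<forall>t\<in>{1..T}.
           gaussian_vec M (W i t) \<and> mean_vec M (W i t) = 0 \<and> cov_mat M (W i t) = \<Sigma>W"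
    and "prob_space.indep_vars M (\<lambda>_. borel)
           (\<lambda>(i, t). if t = 0 then X1 i else W i t) ({1..n} \<times> {0..T})"
    and "\<forall>t\<in>{1..T}. sym_psd (Q t) \<and> sym_psd (P t) \<and> sym_pd (R t)"
    and "Mx T = Q T"
    and "\<forall>t\<in>{1..<T}. Mx t =
           - (transpose (A t) ** Mx (t + 1) ** B t
                ** matrix_inv (transpose (B t) ** Mx (t + 1) ** B t + R t)
                ** transpose (B t) ** Mx (t + 1) ** A t)
           + transpose (A t) ** Mx (t + 1) ** A t + Q t"
    and "Mz T = Q T + P T"
    and "\<forall>t\<in>{1..<T}. Mz t =
           - (transpose (A t + D t) ** Mz (t + 1) ** B t
                ** matrix_inv (transpose (B t) ** Mz (t + 1) ** B t + R t)
                ** transpose (B t) ** Mz (t + 1) ** (A t + D t))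
           + transpose (A t + D t) ** Mz (t + 1) ** (A t + D t) + Q t + P t"
    and "Kx T = 0" and "Kz T = 0"
    and "\<forall>t\<in>{1..<T}. Kx t =
           - (matrix_inv (transpose (B t) ** Mx (t + 1) ** B t + R t)
                ** transpose (B t) ** Mx (t + 1) ** A t)"
    and "\<forall>t\<in>{1..<T}. Kz t =
           - (matrix_inv (transpose (B t) ** Mz (t + 1) ** B t + R t)
                ** transpose (B t) ** Mz (t + 1) ** (A t + D t))"
  shows "(\<forall>t\<in>{1..<T}. invertible (transpose (B t) ** Mx (t + 1) ** B t + R t) \<and>
                      invertible (transpose (B t) ** Mz (t + 1) ** B t + R t)) \<and>
    optimal M n T A B D Q R P X1 W (mean_field_law Kx Kz) \<and>
    (\<forall>g. optimal M n T A B D Q R P X1 W g \<longrightarrow>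
       (\<forall>i\<in>{1..n}. \<forall>t\<in>{1..T}. AE \<omega> in M.
          (let x1 = (\<lambda>i. X1 i \<omega>); w = (\<lambda>i t. W i t \<omega>) in
             action n A B D g x1 w i t =
               Kx t *v state n A B D g x1 w i t
               + (Kz t - Kx t) *v mean_field n A B D g x1 w t \<and>
             action n A B D g x1 w i t =
               action n A B D (mean_field_law Kx Kz) x1 w i t)))"
proof -
  interpret prob_space M by fact
  \<comment> \<open>\<open>add.assoc\<close> groups \<open>Q t + P t\<close>, which enters
    \<open>riccati_step\<close> as a single state weight.\<close>
  interpret mean_field_lqg M n T A D Q P B R X1 W Mx Mz Kx Kz
    by unfold_locales
      (use assms in \<open>auto simp: gaussian_vec_sq_integrable mean_vec_def riccati_step_def
        riccati_gain_def add.assoc\<close>)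
  have "invertible (transpose (B t) ** Mx (t + 1) ** B t + R t) \<and>
      invertible (transpose (B t) ** Mz (t + 1) ** B t + R t)" if "t \<in> {1..<T}" for t
    using that Mx_psd[of "Suc t"] Mz_psd[of "Suc t"] R_pd[of t]
    by (auto intro!: sym_pd_imp_invertible sym_pd_congruence_add)
  moreover have "AE \<omega> in M. let x1 = (\<lambda>i. X1 i \<omega>); w = (\<lambda>i t. W i t \<omega>) in
      action n A B D g x1 w i t = Kx t *v state n A B D g x1 w i t
        + (Kz t - Kx t) *v mean_field n A B D g x1 w t \<and>
      action n A B D g x1 w i t = action n A B D (mean_field_law Kx Kz) x1 w i t"
    if g: "optimal M n T A B D Q R P X1 W g" and i: "i \<in> {1..n}" and t: "t \<in> {1..T}" for g i t
    using optimal_imp_zero_deviation[OF g]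
  proof (rule AE_mp, intro AE_I2 impI)
    fix \<omega> assume dev: "\<forall>i\<in>{1..n}. \<forall>t\<in>{1..T}. deviation g t \<omega> i = 0"
    then have "Ac g i t \<omega> = Ac (mean_field_law Kx Kz) i t \<omega>"
      by (intro zero_deviation_imp_actions_eq t i) auto
    moreover have "deviation g t \<omega> i = 0" using dev i t by blast
    ultimately show "let x1 = (\<lambda>i. X1 i \<omega>); w = (\<lambda>i t. W i t \<omega>) in
      action n A B D g x1 w i t = Kx t *v state n A B D g x1 w i t
        + (Kz t - Kx t) *v mean_field n A B D g x1 w t \<and>
      action n A B D g x1 w i t = action n A B D (mean_field_law Kx Kz) x1 w i t"
      by (simp add: deviation_def)
  qed
  ultimately show ?thesis using mean_field_law_optimal by blast
qed

end
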